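(* Every biconnected outerpath is $B_0$-VPG.
   Context: All graphs are finite and simple. A graph is $B_0$-VPG if it is the intersection graph of a family of axis-parallel (horizontal or vertical) line segments in the plane (degenerate point segments allowed), i.e. each vertex is assigned such a segment and two distinct vertices are adjacent if and only if their segments intersect; equivalently, a vertex intersection graph of $0$-bend paths on a grid. An outerplanar graph is a planar graph admitting a plane embedding with all vertices on the outer face. The weak dual of such an embedding is the graph whose vertices are the bounded faces, two being adjacent when the faces share an edge. An outerpath is an outerplanar graph admitting an outerplanar embedding whose weak dual is a path. A graph is biconnected if it is connected, has at least three vertices... (more precisely: it has no separator of size smaller than $2$). *)

theory Defs
  imports
    "Graph_Theory.Digraph_Component"
    "Graph_Theory.Pair_Digraph"
    "HOL-Analysis.Analysis"
begin

text \<open>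
  A finite simple graph is a \<^locale>\<open>pair_graph\<close>: every edge \<open>{u, v}\<close> is present as the two arcs
  \<open>(u, v)\<close> and \<open>(v, u)\<close>. The plane is \<^typ>\<open>complex\<close>.
\<close>

definition axis_parallel_segment :: "complex set \<Rightarrow> bool" where
  "axis_parallel_segment S \<longleftrightarrow>
     (\<exists>a b. S = closed_segment a b \<and> (Re a = Re b \<or> Im a = Im b))"

definition B0_VPG :: "'a pair_pre_digraph \<Rightarrow> bool" where
  "B0_VPG G \<longleftrightarrow>
     (\<exists>seg :: 'a \<Rightarrow> complex set.
        (\<forall>v \<in> pverts G. axis_parallel_segment (seg v)) \<and>
        (\<forall>u \<in> pverts G. \<forall>v \<in> pverts G. u \<noteq> v \<longrightarrow>
           ((u, v) \<in> parcs G \<longleftrightarrow> seg u \<inter> seg v \<noteq> {})))"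

text \<open>
  Since the library's \<open>connected\<close> is false for the graph without vertices, deleting all vertices
  has to be excluded explicitly. The empty set is a separator iff the graph is disconnected.
\<close>

definition separator :: "'a pair_pre_digraph \<Rightarrow> 'a set \<Rightarrow> bool" where
  "separator G S \<longleftrightarrow> S \<subset> pverts G \<and>
     \<not> Digraph_Component.connected (with_proj G \<restriction> (pverts G - S))"

definition biconnected :: "'a pair_pre_digraph \<Rightarrow> bool" where
  "biconnected G \<longleftrightarrow> \<not> (\<exists>S. separator G S \<and> card S < 2)"

text \<open>
  The two arcs of an edge are drawn as the same curve, traversed in opposite directions.
\<close>

definition plane_embedding ::
  "'a pair_pre_digraph \<Rightarrow> ('a \<Rightarrow> complex) \<Rightarrow> ('a \<times> 'a \<Rightarrow> real \<Rightarrow> complex) \<Rightarrow> bool" where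
  "plane_embedding G p c \<longleftrightarrow>
     inj_on p (pverts G) \<and>
     (\<forall>(u, v) \<in> parcs G.
        arc (c (u, v)) \<and> pathstart (c (u, v)) = p u \<and> pathfinish (c (u, v)) = p v \<and>
        c (v, u) = reversepath (c (u, v)) \<and>
        (\<forall>w \<in> pverts G. p w \<in> path_image (c (u, v)) \<longrightarrow> w \<in> {u, v})) \<and>
     (\<forall>(u, v) \<in> parcs G. \<forall>(x, y) \<in> parcs G. {u, v} \<noteq> {x, y} \<longrightarrow>
        path_image (c (u, v)) \<inter> path_image (c (x, y)) \<subseteq> p ` ({u, v} \<inter> {x, y}))"

definition drawing ::
  "'a pair_pre_digraph \<Rightarrow> ('a \<Rightarrow> complex) \<Rightarrow> ('a \<times> 'a \<Rightarrow> real \<Rightarrow> complex) \<Rightarrow> complex set" where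
  "drawing G p c = p ` pverts G \<union> (\<Union>e \<in> parcs G. path_image (c e))"

definition faces ::
  "'a pair_pre_digraph \<Rightarrow> ('a \<Rightarrow> complex) \<Rightarrow> ('a \<times> 'a \<Rightarrow> real \<Rightarrow> complex) \<Rightarrow> complex set set" where
  "faces G p c = components (- drawing G p c)"

definition outerplanar_embedding ::
  "'a pair_pre_digraph \<Rightarrow> ('a \<Rightarrow> complex) \<Rightarrow> ('a \<times> 'a \<Rightarrow> real \<Rightarrow> complex) \<Rightarrow> bool" where
  "outerplanar_embedding G p c \<longleftrightarrow> plane_embedding G p c \<and>
     (\<exists>F \<in> faces G p c. \<not> bounded F \<and> (\<forall>v \<in> pverts G. p v \<in> frontier F))"

definition weak_dual ::
  "'a pair_pre_digraph \<Rightarrow> ('a \<Rightarrow> complex) \<Rightarrow> ('a \<times> 'a \<Rightarrow> real \<Rightarrow> complex) \<Rightarrow>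
   complex set pair_pre_digraph" where
  "weak_dual G p c =
     \<lparr> pverts = {F \<in> faces G p c. bounded F},
       parcs = {(F, F'). F \<in> faces G p c \<and> bounded F \<and> F' \<in> faces G p c \<and> bounded F' \<and> F \<noteq> F' \<and>
                  (\<exists>e \<in> parcs G. path_image (c e) \<subseteq> frontier F \<and> path_image (c e) \<subseteq> frontier F')} \<rparr>"

text \<open>The graph without vertices counts as a path here; it is the weak dual of a forest.\<close>

definition path_graph :: "'b pair_pre_digraph \<Rightarrow> bool" where
  "path_graph H \<longleftrightarrow>
     (\<exists>xs. distinct xs \<and> pverts H = set xs \<and>
        parcs H = {(xs ! i, xs ! j) | i j.
                     i < length xs \<and> j < length xs \<and> (j = Suc i \<or> i = Suc j)})"

definition outerpath :: "'a pair_pre_digraph \<Rightarrow> bool" where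
  "outerpath G \<longleftrightarrow>
     (\<exists>p c. outerplanar_embedding G p c \<and> path_graph (weak_dual G p c))"

end

theory Submission
  imports Defs
begin

text \<open>
  A theta (three internally disjoint paths with the same ends, each with an inner vertex) has no plane
  drawing with all vertices on the outer face, because one of the paths would lie inside the closed
  curve formed by the other two. Hence a longest cycle of \<open>G\<close> is Hamiltonian, as an ear at a missed
  vertex yields a longer cycle or a theta, and its chords do not cross unless \<open>G\<close> is complete on four
  vertices. The inside of an induced cycle is a bounded face, and induced cycles sharing an
  edge give adjacent faces; as the weak dual is a path, no induced cycle has three such neighbours. So
  \<open>G\<close> arises from an edge by repeatedly gluing a cycle to an edge of the previous one, and a segment
  representation can be extended along with the gluing if the two segments of the current edge are kept
  accessible.
\<close>

section \<open>Segment representations of strips of cycles\<close>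

text \<open>Topology enters through two combinatorial facts, \<open>no_theta\<close> and
  \<open>no_three_neighbours\<close>; everything else concerns the symmetric relation
  \<open>E\<close>. Numbering the vertices along the Hamiltonian cycle turns chords into pairs of
  numbers, and the face beside a chord into an increasing list. The order of the faces is not read
  off the weak dual. The face cut off by an extremal chord serves as a start, and the walk away from
  it cannot branch: at each face, the one just left and two that continue would be three neighbours.
  A theta has at least five vertices, so the complete graph on four vertices contains none. It is
  represented directly, a complete graph being a single point repeated. In the geometry, triangles
  are the obstacle: pairwise intersecting axis-parallel segments have a common point, so a triangle,
  unlike a longer face, cannot be drawn around free space. This dictates the normal forms.\<close>

definition induced_cycle :: "('a \<Rightarrow> 'a \<Rightarrow> bool) \<Rightarrow> 'a list \<Rightarrow> bool" where
  "induced_cycle E ps \<longleftrightarrow> 3 \<le> length ps \<and> distinct ps \<and>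
     (\<forall>i j. i < j \<longrightarrow> j < length ps \<longrightarrow>
        E (ps ! i) (ps ! j) \<longleftrightarrow> j = Suc i \<or> i = 0 \<and> j = length ps - 1)"

text \<open>The last two arguments are the current edge. In \<open>glue\<close> it is the closing
  edge of \<open>ps\<close>, between the last and the first entry, whereas the next current edge
  joins consecutive entries. So each step leaves a face through an edge other than the one by which
  it was entered.\<close>

inductive strip :: "('a \<Rightarrow> 'a \<Rightarrow> bool) \<Rightarrow> 'a set \<Rightarrow> 'a \<Rightarrow> 'a \<Rightarrow> bool" for E where
  edge: "a \<noteq> b \<Longrightarrow> E a b \<Longrightarrow> strip E {a, b} a b"
| flip: "strip E V a b \<Longrightarrow> strip E V b a"
| glue: "strip E V a b \<Longrightarrow> induced_cycle E ps \<Longrightarrow> hd ps = a \<Longrightarrow> last ps = b \<Longrightarrow>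
    set ps \<inter> V = {a, b} \<Longrightarrow> (\<And>x v. x \<in> set ps - V \<Longrightarrow> v \<in> V - {a, b} \<Longrightarrow> \<not> E x v) \<Longrightarrow>
    Suc i < length ps \<Longrightarrow> strip E (V \<union> set ps) (ps ! i) (ps ! Suc i)"

text \<open>Segments are encoded as degenerate rectangles. Intersection then is a conjunction of
  linear inequalities between coordinates, and drawings can be checked by arithmetic.\<close>

datatype box = Box (xl: real) (xr: real) (yl: real) (yr: real)

definition meets :: "box \<Rightarrow> box \<Rightarrow> bool" where
  "meets s t \<longleftrightarrow> xl s \<le> xr t \<and> xl t \<le> xr s \<and> yl s \<le> yr t \<and> yl t \<le> yr s"

definition is_seg :: "box \<Rightarrow> bool" where
  "is_seg s \<longleftrightarrow> xl s \<le> xr s \<and> yl s \<le> yr s \<and> (xl s = xr s \<or> yl s = yr s)"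

definition draws :: "('a \<Rightarrow> 'a \<Rightarrow> bool) \<Rightarrow> 'a set \<Rightarrow> ('a \<Rightarrow> box) \<Rightarrow> bool" where
  "draws E V s \<longleftrightarrow> (\<forall>v \<in> V. is_seg (s v)) \<and>
     (\<forall>u \<in> V. \<forall>v \<in> V. u \<noteq> v \<longrightarrow> (E u v \<longleftrightarrow> meets (s u) (s v)))"

lemma meets_commute: "meets s t \<longleftrightarrow> meets t s"
  by (auto simp: meets_def)

text \<open>
  Three normal forms for the drawing around the current edge \<open>ab\<close>, always with the contact point at the
  origin. In a corner, \<open>a\<close> stands on the origin, \<open>b\<close> ends there from the left, and nothing else reaches
  the lower half plane or the positive x-axis, so \<open>a\<close> may grow downwards and \<open>b\<close> to the right around a
  new face with at least four vertices. A triangle has to pass through the origin, so it needs a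
  corner not occupied by a third segment, or a tip: \<open>a\<close> and \<open>b\<close> are collinear and protrude on the right.
\<close>

definition corner :: "('a \<Rightarrow> 'a \<Rightarrow> bool) \<Rightarrow> 'a set \<Rightarrow> 'a \<Rightarrow> 'a \<Rightarrow> bool" where
  "corner E V a b \<longleftrightarrow> (\<exists>s h w. draws E V s \<and> s a = Box 0 0 0 h \<and> s b = Box w 0 0 0 \<and>
     (\<forall>v \<in> V - {a, b}. 0 < yl (s v) \<or> yl (s v) = 0 \<and> xr (s v) \<le> 0))"

definition clean_corner :: "('a \<Rightarrow> 'a \<Rightarrow> bool) \<Rightarrow> 'a set \<Rightarrow> 'a \<Rightarrow> 'a \<Rightarrow> bool" where
  "clean_corner E V a b \<longleftrightarrow> (\<exists>s h w. draws E V s \<and> s a = Box 0 0 0 h \<and> s b = Box w 0 0 0 \<and>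
     (\<forall>v \<in> V - {a, b}. 0 < yl (s v) \<or> yl (s v) = 0 \<and> xr (s v) < 0))"

definition tip :: "('a \<Rightarrow> 'a \<Rightarrow> bool) \<Rightarrow> 'a set \<Rightarrow> 'a \<Rightarrow> 'a \<Rightarrow> bool" where
  "tip E V a b \<longleftrightarrow> (\<exists>s w w'. draws E V s \<and> s a = Box w 0 0 0 \<and> s b = Box w' 0 0 0 \<and>
     (\<forall>v \<in> V - {a, b}. xr (s v) < 0))"

lemma clean_corner_imp_corner: "clean_corner E V a b \<Longrightarrow> corner E V a b"
  unfolding corner_def clean_corner_def by (meson less_imp_le)

lemma tip_commute: "tip E V a b \<Longrightarrow> tip E V b a"
  unfolding tip_def by (metis insert_commute)

text \<open>Serves to bring a new contact point back to the origin; \<open>f\<close> will be a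
  translation, in some cases combined with a reflection or a quarter turn.\<close>

lemma draws_map:
  assumes "draws E V s" "\<And>b. is_seg b \<Longrightarrow> is_seg (f b)" "\<And>b b'. meets (f b) (f b') = meets b b'"
  shows "draws E V (\<lambda>v. f (s v))"
  using assms by (auto simp: draws_def)

section \<open>Gluing a cycle to a drawing\<close>

definition glued :: "('a \<Rightarrow> 'a \<Rightarrow> bool) \<Rightarrow> 'a set \<Rightarrow> 'a list \<Rightarrow> bool" where
  "glued E V ps \<longleftrightarrow> symp E \<and> finite V \<and> induced_cycle E ps \<and> set ps \<inter> V = {hd ps, last ps} \<and>
     (\<forall>x \<in> set ps - V. \<forall>v \<in> V - {hd ps, last ps}. \<not> E x v)"

text \<open>Reversal exchanges the two ends of the current edge, so that constructions for one
  orientation of a normal form cover the other as well.\<close>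

lemma glued_rev:
  assumes "glued E V ps" shows "glued E V (rev ps)"
proof -
  have ne: "ps \<noteq> []" and l: "3 \<le> length ps" and s: "symp E"
    using assms by (auto simp: glued_def induced_cycle_def)
  have ind: "E (ps ! i) (ps ! j) \<longleftrightarrow> j = Suc i \<or> i = 0 \<and> j = length ps - 1"
    if "i < j" "j < length ps" for i j
    using assms that by (auto simp: glued_def induced_cycle_def)
  have "induced_cycle E (rev ps)"
    unfolding induced_cycle_def
  proof (intro conjI allI impI)
    show "3 \<le> length (rev ps)" using l by simp
    show "distinct (rev ps)" using assms by (simp add: glued_def induced_cycle_def)
    fix i j assume ij: "i < j" "j < length (rev ps)"
    have "E (rev ps ! i) (rev ps ! j) = E (ps ! (length ps - Suc i)) (ps ! (length ps - Suc j))"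
      using ij by (simp add: rev_nth)
    also have "\<dots> = E (ps ! (length ps - Suc j)) (ps ! (length ps - Suc i))"
      using s by (auto dest: sympD)
    also have "\<dots> \<longleftrightarrow> length ps - Suc i = Suc (length ps - Suc j) \<or>
        length ps - Suc j = 0 \<and> length ps - Suc i = length ps - 1"
      by (rule ind) (use ij in auto)
    also have "\<dots> \<longleftrightarrow> j = Suc i \<or> i = 0 \<and> j = length (rev ps) - 1"
      using ij by auto
    finally show "E (rev ps ! i) (rev ps ! j) \<longleftrightarrow> j = Suc i \<or> i = 0 \<and> j = length (rev ps) - 1" .
  qed
  then show ?thesis
    using assms ne by (auto simp: glued_def hd_rev last_rev)
qed

text \<open>Besides placing the inner vertices of \<open>ps\<close>, \<open>f\<close> may redraw the
  two end vertices. This is how old segments grow around the new face; \<open>ends\<close> ensures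
  that they gain and lose no contact with the rest of the old drawing.\<close>

lemma draws_glue:
  assumes g: "glued E V ps" and r: "length ps = Suc r" and s: "draws E V s"
    and seg: "\<And>j. j \<le> r \<Longrightarrow> is_seg (f j)"
    and new: "\<And>i j. i < j \<Longrightarrow> j \<le> r \<Longrightarrow> meets (f i) (f j) \<longleftrightarrow> j = Suc i \<or> i = 0 \<and> j = r"
    and old: "\<And>j v. 0 < j \<Longrightarrow> j < r \<Longrightarrow> v \<in> V - {hd ps, last ps} \<Longrightarrow> \<not> meets (f j) (s v)"
    and ends: "\<And>v. v \<in> V - {hd ps, last ps} \<Longrightarrow> meets (f 0) (s v) = meets (s (hd ps)) (s v)"
      "\<And>v. v \<in> V - {hd ps, last ps} \<Longrightarrow> meets (f r) (s v) = meets (s (last ps)) (s v)"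
  obtains t where "draws E (V \<union> set ps) t" "\<And>j. j \<le> r \<Longrightarrow> t (ps ! j) = f j"
    "\<And>v. v \<in> V - {hd ps, last ps} \<Longrightarrow> t v = s v"
proof -
  have sym: "E x y \<longleftrightarrow> E y x" for x y using g by (auto simp: glued_def dest: sympD)
  have d: "distinct ps" and ne: "ps \<noteq> []" and r2: "2 \<le> r"
    using g r by (auto simp: glued_def induced_cycle_def)
  have hl: "hd ps = ps ! 0" "last ps = ps ! r"
    using ne r by (auto simp: hd_conv_nth last_conv_nth)
  \<comment> \<open>Distinctness of \<open>ps\<close> makes the index unique. The ends of
    \<open>ps\<close> lie in \<open>V\<close> too, and here the new box takes precedence over the
    old one.\<close>
  define t where "t v = (if v \<in> set ps then f (THE j. j \<le> r \<and> ps ! j = v) else s v)" for v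
  have tf: "t (ps ! j) = f j" if "j \<le> r" for j
  proof -
    have "(THE k. k \<le> r \<and> ps ! k = ps ! j) = j"
      using that d r by (intro the_equality) (auto simp: nth_eq_iff_index_eq)
    then show ?thesis using that r by (simp add: t_def)
  qed
  have setps: "\<exists>j \<le> r. v = ps ! j" if "v \<in> set ps" for v
    using that r by (metis in_set_conv_nth less_Suc_eq_le)
  have ts: "t v = s v" "v \<notin> set ps" if "v \<in> V - {hd ps, last ps}" for v
    using that g by (auto simp: t_def glued_def)
  have psV: "ps ! j \<notin> V" "ps ! j \<in> set ps" if "0 < j" "j < r" for j
  proof -
    show "ps ! j \<in> set ps" using that r by simp
    then show "ps ! j \<notin> V"
      using g that d r unfolding glued_def hl
      by (metis IntI insertE singletonD nth_eq_iff_index_eq less_SucI less_irrefl lessI zero_less_Suc)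
  qed
  have pp: "E (ps ! i) (ps ! j) \<longleftrightarrow> meets (f i) (f j)" if "i < j" "j \<le> r" for i j
    using g that new r by (auto simp: glued_def induced_cycle_def)
  have po: "E (ps ! j) v \<longleftrightarrow> meets (f j) (s v)" if "j \<le> r" "v \<in> V - {hd ps, last ps}" for j v
  proof -
    consider "j = 0" | "j = r" | "0 < j" "j < r" using \<open>j \<le> r\<close> by linarith
    then show ?thesis
    proof cases
      case 1
      have "ps ! 0 \<in> V" using g hl by (auto simp: glued_def)
      then show ?thesis using 1 s ends(1) that hl unfolding draws_def by auto
    next
      case 2
      have "ps ! r \<in> V" using g hl by (auto simp: glued_def)
      then show ?thesis using 2 s ends(2) that hl unfolding draws_def by auto
    next
      case 3
      then show ?thesis using psV[of j] old that g unfolding glued_def by blast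
    qed
  qed
  have cases: "(\<exists>j \<le> r. v = ps ! j) \<or> v \<in> V - {hd ps, last ps}" if "v \<in> V \<union> set ps" for v
    using that setps ne by (metis Diff_iff Un_iff empty_iff hd_in_set insert_iff last_in_set)
  have "draws E (V \<union> set ps) t"
    unfolding draws_def
  proof (intro conjI ballI impI)
    fix v assume "v \<in> V \<union> set ps"
    then show "is_seg (t v)" using cases[of v] seg tf ts s by (auto simp: draws_def)
  next
    fix u v assume uv: "u \<in> V \<union> set ps" "v \<in> V \<union> set ps" "u \<noteq> v"
    from cases[OF uv(1)] cases[OF uv(2)]
    consider i j where "i \<le> r" "j \<le> r" "u = ps ! i" "v = ps ! j"
      | i where "i \<le> r" "u = ps ! i" "v \<in> V - {hd ps, last ps}"
      | j where "j \<le> r" "v = ps ! j" "u \<in> V - {hd ps, last ps}"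
      | "u \<in> V - {hd ps, last ps}" "v \<in> V - {hd ps, last ps}"
      by blast
    then show "E u v \<longleftrightarrow> meets (t u) (t v)"
    proof cases
      case (1 i j)
      then have "i < j \<or> j < i" using uv by (metis nat_neq_iff)
      then show ?thesis using 1 pp tf sym meets_commute by metis
    next
      case (2 i)
      then show ?thesis using po tf ts by simp
    next
      case (3 j)
      then show ?thesis using po tf ts sym meets_commute by simp
    next
      case 4
      then show ?thesis using s ts uv by (simp add: draws_def)
    qed
  qed
  then show ?thesis using that tf ts by blast
qed

lemma glued_nth:
  assumes "glued E V ps" "length ps = Suc r"
  shows "hd ps = ps ! 0" "last ps = ps ! r" "2 \<le> r" "hd ps \<in> V" "last ps \<in> V"
    "\<And>v. v \<in> V \<union> set ps \<Longrightarrow> v \<in> V - {hd ps, last ps} \<or> (\<exists>j \<le> r. v = ps ! j)"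
proof -
  have ne: "ps \<noteq> []" using assms by auto
  show "hd ps = ps ! 0" "last ps = ps ! r" using ne assms by (auto simp: hd_conv_nth last_conv_nth)
  show "2 \<le> r" using assms by (auto simp: glued_def induced_cycle_def)
  show "hd ps \<in> V" "last ps \<in> V" using assms by (auto simp: glued_def)
  show "v \<in> V - {hd ps, last ps} \<or> (\<exists>j \<le> r. v = ps ! j)" if "v \<in> V \<union> set ps" for v
    using that ne assms(2)
      by (metis Diff_iff Un_iff empty_iff hd_in_set insert_iff last_in_set in_set_conv_nth
        less_Suc_eq_le)
qed

section \<open>Faces with at least four vertices\<close>

lemma ex_right_bound:
  fixes s :: "'a \<Rightarrow> box" assumes "finite V"
  obtains K where "0 < K" "\<And>v. v \<in> V \<Longrightarrow> xr (s v) < K"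
proof
  let ?K = "Max (insert 0 ((\<lambda>v. xr (s v)) ` V)) + 1"
  have m: "m \<le> Max (insert 0 ((\<lambda>v. xr (s v)) ` V))" if "m \<in> insert 0 ((\<lambda>v. xr (s v)) ` V)" for m
    using that assms by (intro Max_ge) auto
  show "0 < ?K" using m[of 0] by simp
  show "xr (s v) < ?K" if "v \<in> V" for v using m[of "xr (s v)"] that by simp
qed

text \<open>The new face becomes a rectangle in the fourth quadrant. Its left side is the downward
  extension of \<open>ps ! 0\<close>, its bottom is \<open>ps ! 1\<close>, its right side consists
  of the other new vertices, and its top is the extension of \<open>ps ! r\<close>. The required
  corner is the lower left one; a reflection makes \<open>ps ! 1\<close> end there from the
  left.\<close>

lemma big_face_keep_vertical:
  assumes g: "glued E V ps" and r: "length ps = Suc r" "3 \<le> r" and c: "corner E V (hd ps) (last ps)"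
  shows "clean_corner E (V \<union> set ps) (ps ! 0) (ps ! 1)"
proof -
  obtain s h w where s: "draws E V s" "s (hd ps) = Box 0 0 0 h" "s (last ps) = Box w 0 0 0"
    and oth: "\<And>v. v \<in> V - {hd ps, last ps} \<Longrightarrow> 0 < yl (s v) \<or> yl (s v) = 0 \<and> xr (s v) \<le> 0"
    using c unfolding corner_def by blast
  note nth = glued_nth[OF g r(1)]
  have seg: "is_seg (s v)" if "v \<in> V" for v using s that by (auto simp: draws_def)
  have hw: "0 \<le> h" "w \<le> 0" using seg[OF nth(4)] seg[OF nth(5)] s by (auto simp: is_seg_def)
  \<comment> \<open>The right side is a stack of the \<open>r - 2\<close> unit segments of
    \<open>ps ! 2\<close>, ..., \<open>ps ! (r - 1)\<close>, from height \<open>-D\<close> up to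
    0.\<close>
  define D where "D = real r - 2"
  have D: "1 \<le> D" using r by (simp add: D_def)
  define f where "f j = (if j = 0 then Box 0 0 (-D) h else if j = r then Box w 1 0 0
    else if j = 1 then Box 0 1 (-D) (-D) else Box 1 1 (real j - 2 - D) (real j - 1 - D))" for j
  obtain t where t: "draws E (V \<union> set ps) t" "\<And>j. j \<le> r \<Longrightarrow> t (ps ! j) = f j"
    "\<And>v. v \<in> V - {hd ps, last ps} \<Longrightarrow> t v = s v"
  proof (rule draws_glue[OF g r(1) s(1), of f])
    show "is_seg (f j)" if "j \<le> r" for j
      using hw D by (auto simp: f_def is_seg_def)
    show "meets (f i) (f j) \<longleftrightarrow> j = Suc i \<or> i = 0 \<and> j = r" if "i < j" "j \<le> r" for i j
      using hw r that by (auto simp: f_def meets_def D_def)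
    show "\<not> meets (f j) (s v)" if "0 < j" "j < r" "v \<in> V - {hd ps, last ps}" for j v
      using oth[OF that(3)] that(1,2) D r(2) by (auto simp: f_def meets_def D_def)
    show "meets (f 0) (s v) = meets (s (hd ps)) (s v)" if "v \<in> V - {hd ps, last ps}" for v
      using oth[OF that] seg[of v] that D by (auto simp: f_def meets_def is_seg_def s)
    show "meets (f r) (s v) = meets (s (last ps)) (s v)" if "v \<in> V - {hd ps, last ps}" for v
      using oth[OF that] seg[of v] that r(2) by (auto simp: f_def meets_def is_seg_def s)
  qed blast
  define m where "m = (\<lambda>b. Box (- xr b) (- xl b) (yl b + D) (yr b + D))"
  have "draws E (V \<union> set ps) (\<lambda>v. m (t v))"
    by (rule draws_map[OF t(1)]) (auto simp: m_def is_seg_def meets_def)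
  moreover have "m (t (ps ! 0)) = Box 0 0 0 (h + D)" "m (t (ps ! 1)) = Box (-1) 0 0 0"
    using r t(2) by (auto simp: m_def f_def)
  moreover have "0 < yl (m (t v)) \<or> yl (m (t v)) = 0 \<and> xr (m (t v)) < 0"
    if v: "v \<in> V \<union> set ps - {ps ! 0, ps ! 1}" for v
  proof -
    from v have "v \<in> V \<union> set ps" by blast
    from nth(6)[OF this] v consider "v \<in> V - {hd ps, last ps}" | j where "j \<le> r" "v = ps ! j"
      "j \<noteq> 0" "j \<noteq> 1"
      by (metis DiffD1 DiffD2 insertI1 insertI2)
    then show ?thesis
    proof cases
      case 1 then show ?thesis using oth[OF 1] D t(3) by (auto simp: m_def)
    next
      case 2 then show ?thesis using D t(2) by (auto simp: m_def f_def)
    qed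
  qed
  ultimately show ?thesis unfolding clean_corner_def by blast
qed

text \<open>Here the required corner is the upper right one of the rectangle, so its right side is
  the single segment \<open>ps ! (r - 1)\<close> and the other new vertices subdivide the bottom.
  The quarter turn at the end makes \<open>ps ! r\<close> vertical and turns the part of the plane
  right of the rectangle into the lower half plane. Hence the rectangle has to reach beyond all old
  segments.\<close>

lemma big_face_keep_horizontal:
  assumes g: "glued E V ps" and r: "length ps = Suc r" "3 \<le> r" and c: "corner E V (hd ps) (last ps)"
  shows "clean_corner E (V \<union> set ps) (ps ! r) (ps ! (r - 1))"
proof -
  obtain s h w where s: "draws E V s" "s (hd ps) = Box 0 0 0 h" "s (last ps) = Box w 0 0 0"
    and oth: "\<And>v. v \<in> V - {hd ps, last ps} \<Longrightarrow> 0 < yl (s v) \<or> yl (s v) = 0 \<and> xr (s v) \<le> 0"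
    using c unfolding corner_def by blast
  note nth = glued_nth[OF g r(1)]
  have seg: "is_seg (s v)" if "v \<in> V" for v using s that by (auto simp: draws_def)
  have hw: "0 \<le> h" "w \<le> 0" using seg[OF nth(4)] seg[OF nth(5)] s by (auto simp: is_seg_def)
  obtain K where K: "0 < K" "\<And>v. v \<in> V \<Longrightarrow> xr (s v) < K"
    using ex_right_bound g unfolding glued_def by blast
  \<comment> \<open>The left end of the \<open>j\<close>-th segment of the bottom side. Steps of
    width \<open>K\<close> make \<open>R\<close> at least \<open>K\<close>, because \<open>r\<close>
    is at least 3.\<close>
  define x where "x j = K * (real j - 1)" for j
  have x_le: "x i \<le> x j \<longleftrightarrow> i \<le> j" for i j using K(1) by (simp add: x_def)
  have x_eq: "x i = x j \<longleftrightarrow> i = j" for i j using K(1) by (simp add: x_def)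
  have x1: "x 1 = 0" by (simp add: x_def)
  have x_pos: "0 < x j" "0 \<le> x j" "x j \<noteq> 0" if "1 < j" for j using x_le[of j 1] x1 that by auto
  define R where "R = x (r - 1)"
  have "1 * K \<le> (real (r - 1) - 1) * K" using K(1) r(2) by (intro mult_right_mono) auto
  then have KR: "K \<le> R" by (simp add: R_def x_def mult.commute)
  have R: "0 < R" using K KR by simp
  define f where "f j = (if j = 0 then Box 0 0 (-1) h else if j = r then Box w R 0 0
    else if j = r - 1 then Box R R (-1) 0 else Box (x j) (x (Suc j)) (-1) (-1))" for j
  have f0: "f 0 = Box 0 0 (-1) h" and fr: "f r = Box w R 0 0"
    and fr1: "f (r - Suc 0) = Box R R (-1) 0"
    using r(2) by (auto simp: f_def)
  have fb: "f j = Box (x j) (x (Suc j)) (-1) (-1)" if "0 < j" "Suc j < r" for j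
    using that by (auto simp: f_def)
  obtain t where t: "draws E (V \<union> set ps) t" "\<And>j. j \<le> r \<Longrightarrow> t (ps ! j) = f j"
    "\<And>v. v \<in> V - {hd ps, last ps} \<Longrightarrow> t v = s v"
  proof (rule draws_glue[OF g r(1) s(1), of f])
    show "is_seg (f j)" if "j \<le> r" for j
      using hw R that by (auto simp: f_def is_seg_def x_le)
    show "meets (f i) (f j) \<longleftrightarrow> j = Suc i \<or> i = 0 \<and> j = r" if ij: "i < j" "j \<le> r" for i j
    proof -
      consider "j = r" "i = 0" | "j = r" "i = r - 1" | "j = r" "0 < i" "Suc i < r"
        | "j = r - 1" "i = 0" | "j = r - 1" "0 < i" | "Suc j < r" "i = 0" | "Suc j < r" "0 < i"
        using ij by linarith
      then show ?thesis
      proof cases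
        case 1 then show ?thesis using hw R by (simp add: f0 fr meets_def)
      next
        case 2 then show ?thesis using hw R r ij by (simp add: fr fr1 meets_def)
      next
        case 3 then show ?thesis by (simp add: fb fr meets_def)
      next
        case 4 then show ?thesis using R r by (auto simp: f0 fr1 meets_def)
      next
        case 5 then show ?thesis using ij r by (auto simp: fb fr1 meets_def x_le R_def)
      next
        case 6 then show ?thesis using ij x_le[of j 1] x_le[of 1 "Suc j"] x1 hw
          by (auto simp: f0 fb meets_def)
      next
        case 7 then show ?thesis using ij by (auto simp: fb meets_def x_le)
      qed
    qed
    show "\<not> meets (f j) (s v)" if j: "0 < j" "j < r" and v: "v \<in> V - {hd ps, last ps}" for j v
    proof (cases "j = r - 1")
      case True
      then show ?thesis using K(2)[of v] KR v by (auto simp: fr1 meets_def)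
    next
      case False
      then show ?thesis using j fb[of j] oth[OF v] by (auto simp: meets_def)
    qed
    show "meets (f 0) (s v) = meets (s (hd ps)) (s v)" if "v \<in> V - {hd ps, last ps}" for v
      using oth[OF that] seg[of v] that by (auto simp: f0 meets_def is_seg_def s)
    show "meets (f r) (s v) = meets (s (last ps)) (s v)" if "v \<in> V - {hd ps, last ps}" for v
      using oth[OF that] seg[of v] that R by (auto simp: fr meets_def is_seg_def s)
  qed blast
  define m where "m = (\<lambda>b. Box (yl b) (yr b) (R - xr b) (R - xl b))"
  have "draws E (V \<union> set ps) (\<lambda>v. m (t v))"
    by (rule draws_map[OF t(1)]) (auto simp: m_def is_seg_def meets_def)
  moreover have "m (t (ps ! r)) = Box 0 0 0 (R - w)" "m (t (ps ! (r - 1))) = Box (-1) 0 0 0"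
    using r t(2) by (auto simp: m_def fr fr1)
  moreover have "0 < yl (m (t v)) \<or> yl (m (t v)) = 0 \<and> xr (m (t v)) < 0"
    if v: "v \<in> V \<union> set ps - {ps ! r, ps ! (r - 1)}" for v
  proof -
    from v have "v \<in> V \<union> set ps" by blast
    from nth(6)[OF this] v consider "v \<in> V - {hd ps, last ps}" | "v = ps ! 0"
      | j where "0 < j" "Suc j < r" "v = ps ! j"
      by (metis DiffD2 Suc_lessI diff_Suc_1 insertI1 insertI2 le_eq_less_or_eq neq0_conv)
    then show ?thesis
    proof cases
      case 1 then show ?thesis using K(2)[of v] KR t(3) by (auto simp: m_def)
    next
      case 2 then show ?thesis using R t(2)[of 0] by (auto simp: m_def f0)
    next
      case 3 then show ?thesis using t(2)[of j] x_le[of "Suc j" "r - 1"]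
        by (auto simp: m_def fb R_def)
    qed
  qed
  ultimately show ?thesis unfolding clean_corner_def by blast
qed

text \<open>The required corner is the lower right one: \<open>ps ! 1\<close>, ...,
  \<open>ps ! i\<close> form the bottom of the rectangle and the later new vertices its right side,
  all in unit segments. This fixes the width \<open>i\<close> and the height \<open>D\<close>, and a
  translation suffices.\<close>

lemma big_face_new_edge:
  assumes g: "glued E V ps" and r: "length ps = Suc r" "3 \<le> r" and c: "corner E V (hd ps) (last ps)"
    and i: "0 < i" "Suc i < r"
  shows "clean_corner E (V \<union> set ps) (ps ! Suc i) (ps ! i)"
proof -
  obtain s h w where s: "draws E V s" "s (hd ps) = Box 0 0 0 h" "s (last ps) = Box w 0 0 0"
    and oth: "\<And>v. v \<in> V - {hd ps, last ps} \<Longrightarrow> 0 < yl (s v) \<or> yl (s v) = 0 \<and> xr (s v) \<le> 0"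
    using c unfolding corner_def by blast
  note nth = glued_nth[OF g r(1)]
  have seg: "is_seg (s v)" if "v \<in> V" for v using s that by (auto simp: draws_def)
  have hw: "0 \<le> h" "w \<le> 0" using seg[OF nth(4)] seg[OF nth(5)] s by (auto simp: is_seg_def)
  define D where "D = real r - 1 - real i"
  have D: "1 \<le> D" using i by (simp add: D_def)
  define f where "f j = (if j = 0 then Box 0 0 (-D) h else if j = r then Box w (real i) 0 0
    else if j \<le> i then Box (real j - 1) (real j) (-D) (-D)
    else Box (real i) (real i) (real j - real i - 1 - D) (real j - real i - D))" for j
  obtain t where t: "draws E (V \<union> set ps) t" "\<And>j. j \<le> r \<Longrightarrow> t (ps ! j) = f j"
    "\<And>v. v \<in> V - {hd ps, last ps} \<Longrightarrow> t v = s v"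
  proof (rule draws_glue[OF g r(1) s(1), of f])
    show "is_seg (f j)" if "j \<le> r" for j
      using hw D by (auto simp: f_def is_seg_def)
    show "meets (f k) (f j) \<longleftrightarrow> j = Suc k \<or> k = 0 \<and> j = r" if "k < j" "j \<le> r" for k j
      using hw r i that by (auto simp: f_def meets_def D_def)
    show "\<not> meets (f j) (s v)" if "0 < j" "j < r" "v \<in> V - {hd ps, last ps}" for j v
      using oth[OF that(3)] that(1,2) D r(2) i by (auto simp: f_def meets_def D_def)
    show "meets (f 0) (s v) = meets (s (hd ps)) (s v)" if "v \<in> V - {hd ps, last ps}" for v
      using oth[OF that] seg[of v] that D by (auto simp: f_def meets_def is_seg_def s)
    show "meets (f r) (s v) = meets (s (last ps)) (s v)" if "v \<in> V - {hd ps, last ps}" for v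
      using oth[OF that] seg[of v] that r(2) by (auto simp: f_def meets_def is_seg_def s)
  qed blast
  define m where "m = (\<lambda>b. Box (xl b - real i) (xr b - real i) (yl b + D) (yr b + D))"
  have "draws E (V \<union> set ps) (\<lambda>v. m (t v))"
    by (rule draws_map[OF t(1)]) (auto simp: m_def is_seg_def meets_def)
  moreover have "m (t (ps ! Suc i)) = Box 0 0 0 1" "m (t (ps ! i)) = Box (-1) 0 0 0"
    using i t(2) by (auto simp: m_def f_def)
  moreover have "0 < yl (m (t v)) \<or> yl (m (t v)) = 0 \<and> xr (m (t v)) < 0"
    if v: "v \<in> V \<union> set ps - {ps ! Suc i, ps ! i}" for v
  proof -
    from v have "v \<in> V \<union> set ps" by blast
    from nth(6)[OF this] v consider "v \<in> V - {hd ps, last ps}" | j where "j \<le> r" "v = ps ! j"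
      "j \<noteq> Suc i" "j \<noteq> i"
      by (metis DiffD1 DiffD2 insertI1 insertI2)
    then show ?thesis
    proof cases
      case 1 then show ?thesis using oth[OF 1] D t(3) by (auto simp: m_def)
    next
      case 2 then show ?thesis using D i t(2) by (auto simp: m_def f_def)
    qed
  qed
  ultimately show ?thesis unfolding clean_corner_def by blast
qed

lemma big_face:
  assumes g: "glued E V ps" and r: "4 \<le> length ps" and c: "corner E V (hd ps) (last ps)"
    and i: "Suc i < length ps"
  shows "clean_corner E (V \<union> set ps) (ps ! i) (ps ! Suc i) \<or> clean_corner E (V \<union> set ps) (ps ! Suc i) (ps ! i)"
proof -
  obtain r where r: "length ps = Suc r" "3 \<le> r" using assms(2) by (cases "length ps") auto
  consider "i = 0" | "0 < i" "Suc i < r" | "Suc i = r" using i r by linarith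
  then show ?thesis
    using big_face_keep_vertical[OF g r c] big_face_keep_horizontal[OF g r c] big_face_new_edge[OF g
      r c, of i]
    by cases auto
qed

section \<open>Triangles\<close>

lemma triangle_nth:
  assumes "glued E V ps" "length ps = 3"
  shows "ps = [ps ! 0, ps ! 1, ps ! 2]" "hd ps = ps ! 0" "last ps = ps ! 2"
    "V \<union> set ps = insert (ps ! 1) V" "ps ! 1 \<notin> V" "ps ! 0 \<in> V" "ps ! 2 \<in> V" "ps ! 0 \<noteq> ps ! 2"
proof -
  show *: "ps = [ps ! 0, ps ! 1, ps ! 2]"
    using assms(2) by (auto intro!: nth_equalityI simp: less_Suc_eq numeral_3_eq_3 numeral_2_eq_2)
  show hl: "hd ps = ps ! 0" "last ps = ps ! 2"
    by (subst *, simp)+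
  have V: "set ps \<inter> V = {ps ! 0, ps ! 2}" and d: "distinct ps"
    using assms hl by (auto simp: glued_def induced_cycle_def)
  have s: "set ps = {ps ! 0, ps ! 1, ps ! 2}" by (subst *, simp)
  show "ps ! 0 \<in> V" "ps ! 2 \<in> V" using V by auto
  then show "V \<union> set ps = insert (ps ! 1) V" unfolding s by auto
  have "ps ! 1 \<noteq> ps ! 0" "ps ! 1 \<noteq> ps ! 2" "ps ! 0 \<noteq> ps ! 2"
    using d assms(2) by (auto simp: nth_eq_iff_index_eq)
  then show "ps ! 1 \<notin> V" "ps ! 0 \<noteq> ps ! 2" using V s by auto
qed

lemma draws_triangle:
  assumes g: "glued E V ps" "length ps = 3" and s: "draws E V s"
    and seg: "is_seg A" "is_seg B" "is_seg C" and m: "meets A C" "meets C B" "meets A B"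
    and old: "\<And>v. v \<in> V - {hd ps, last ps} \<Longrightarrow> \<not> meets C (s v)"
      "\<And>v. v \<in> V - {hd ps, last ps} \<Longrightarrow> meets A (s v) = meets (s (hd ps)) (s v)"
      "\<And>v. v \<in> V - {hd ps, last ps} \<Longrightarrow> meets B (s v) = meets (s (last ps)) (s v)"
  obtains t where "draws E (V \<union> set ps) t" "t (ps ! 0) = A" "t (ps ! 1) = C" "t (ps ! 2) = B"
    "\<And>v. v \<in> V - {hd ps, last ps} \<Longrightarrow> t v = s v"
proof -
  define f where "f j = (if j = 0 then A else if j = 1 then C else B)" for j :: nat
  have r: "length ps = Suc 2" using g by simp
  obtain t where t: "draws E (V \<union> set ps) t" "\<And>j. j \<le> 2 \<Longrightarrow> t (ps ! j) = f j"
    "\<And>v. v \<in> V - {hd ps, last ps} \<Longrightarrow> t v = s v"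
  proof (rule draws_glue[OF g(1) r s, of f])
    show "is_seg (f j)" for j using seg by (auto simp: f_def)
    show "meets (f i) (f j) \<longleftrightarrow> j = Suc i \<or> i = 0 \<and> j = 2" if "i < j" "j \<le> 2" for i j
      using that m by (auto simp: f_def)
    show "\<not> meets (f j) (s v)" if "0 < j" "j < 2" "v \<in> V - {hd ps, last ps}" for j v
      using that old by (auto simp: f_def)
    show "meets (f 0) (s v) = meets (s (hd ps)) (s v)" if "v \<in> V - {hd ps, last ps}" for v
      using old(2)[OF that] by (simp add: f_def)
    show "meets (f 2) (s v) = meets (s (last ps)) (s v)" if "v \<in> V - {hd ps, last ps}" for v
      using old(3)[OF that] by (simp add: f_def)
  qed blast
  then show ?thesis using that[of t] by (simp add: f_def)
qed

text \<open>The new vertex is the contact point itself, which in a clean corner lies on no third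
  segment. A point is both horizontal and vertical, so one drawing serves both new edges. The third
  segment of the triangle now ends at the origin, so the corners obtained here are not the clean
  ones.\<close>

lemma triangle_corner_to_corner:
  assumes g: "glued E V ps" "length ps = 3" and c: "clean_corner E V (hd ps) (last ps)"
  shows "corner E (V \<union> set ps) (ps ! 0) (ps ! 1)" "corner E (V \<union> set ps) (ps ! 1) (ps ! 2)"
proof -
  obtain s h w where s: "draws E V s" "s (hd ps) = Box 0 0 0 h" "s (last ps) = Box w 0 0 0"
    and oth: "\<And>v. v \<in> V - {hd ps, last ps} \<Longrightarrow> 0 < yl (s v) \<or> yl (s v) = 0 \<and> xr (s v) < 0"
    using c unfolding clean_corner_def by blast
  note nth = triangle_nth[OF g]
  have seg: "is_seg (s v)" if "v \<in> V" for v using s that by (auto simp: draws_def)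
  have hw: "0 \<le> h" "w \<le> 0" using seg[of "hd ps"] seg[of "last ps"] s nth by (auto simp: is_seg_def)
  obtain t where t: "draws E (V \<union> set ps) t" "t (ps ! 0) = Box 0 0 0 h" "t (ps ! 1) = Box 0 0 0 0"
    "t (ps ! 2) = Box w 0 0 0" "\<And>v. v \<in> V - {hd ps, last ps} \<Longrightarrow> t v = s v"
  proof (rule draws_triangle[OF g s(1), of "Box 0 0 0 h" "Box w 0 0 0" "Box 0 0 0 0"])
    show "\<not> meets (Box 0 0 0 0) (s v)" if "v \<in> V - {hd ps, last ps}" for v
      using oth[OF that] by (auto simp: meets_def)
  qed (use hw s in \<open>auto simp: is_seg_def meets_def\<close>)
  have oth': "0 < yl (t v) \<or> yl (t v) = 0 \<and> xr (t v) \<le> 0" if "v \<in> V" for v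
  proof (cases "v \<in> {hd ps, last ps}")
    case True then show ?thesis using t nth by auto
  next
    case False then show ?thesis using t(5)[of v] oth[of v] that by auto
  qed
  show "corner E (V \<union> set ps) (ps ! 0) (ps ! 1)"
    unfolding corner_def using t nth oth' by (intro exI[of _ t] exI[of _ h] exI[of _ 0]) auto
  show "corner E (V \<union> set ps) (ps ! 1) (ps ! 2)"
    unfolding corner_def using t nth oth' by (intro exI[of _ t] exI[of _ w] exI[of _ 0]) auto
qed

text \<open>The lower half plane is free, so \<open>ps ! 0\<close> can grow into it together with
  the new segment. A quarter turn makes this direction point to the right.\<close>

lemma triangle_corner_to_tip_vertical:
  assumes g: "glued E V ps" "length ps = 3" and c: "clean_corner E V (hd ps) (last ps)"
  shows "tip E (V \<union> set ps) (ps ! 0) (ps ! 1)"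
proof -
  obtain s h w where s: "draws E V s" "s (hd ps) = Box 0 0 0 h" "s (last ps) = Box w 0 0 0"
    and oth: "\<And>v. v \<in> V - {hd ps, last ps} \<Longrightarrow> 0 < yl (s v) \<or> yl (s v) = 0 \<and> xr (s v) < 0"
    using c unfolding clean_corner_def by blast
  note nth = triangle_nth[OF g]
  have seg: "is_seg (s v)" if "v \<in> V" for v using s that by (auto simp: draws_def)
  have hw: "0 \<le> h" "w \<le> 0" using seg[of "hd ps"] seg[of "last ps"] s nth by (auto simp: is_seg_def)
  obtain t where t: "draws E (V \<union> set ps) t" "t (ps ! 0) = Box 0 0 (-1) h"
    "t (ps ! 1) = Box 0 0 (-1) 0"
    "t (ps ! 2) = Box w 0 0 0" "\<And>v. v \<in> V - {hd ps, last ps} \<Longrightarrow> t v = s v"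
  proof (rule draws_triangle[OF g s(1), of "Box 0 0 (-1) h" "Box w 0 0 0" "Box 0 0 (-1) 0"])
    show "\<not> meets (Box 0 0 (-1) 0) (s v)" if "v \<in> V - {hd ps, last ps}" for v
      using oth[OF that] by (auto simp: meets_def)
    show "meets (Box 0 0 (-1) h) (s v) = meets (s (hd ps)) (s v)" if "v \<in> V - {hd ps, last ps}" for v
      using oth[OF that] seg[of v] that by (auto simp: meets_def is_seg_def s)
  qed (use hw s in \<open>auto simp: is_seg_def meets_def\<close>)
  define m where "m = (\<lambda>b. Box (- yr b - 1) (- yl b - 1) (xl b) (xr b))"
  have "draws E (V \<union> set ps) (\<lambda>v. m (t v))"
    by (rule draws_map[OF t(1)]) (auto simp: m_def is_seg_def meets_def)
  moreover have "m (t (ps ! 0)) = Box (-h-1) 0 0 0" "m (t (ps ! 1)) = Box (-1) 0 0 0"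
    using t by (auto simp: m_def)
  moreover have "xr (m (t v)) < 0" if v: "v \<in> V \<union> set ps - {ps ! 0, ps ! 1}" for v
  proof (cases "v = ps ! 2")
    case True then show ?thesis using t by (simp add: m_def)
  next
    case False
    then have "v \<in> V - {hd ps, last ps}" using v nth by auto
    then show ?thesis using t(5)[of v] oth[of v] by (auto simp: m_def)
  qed
  ultimately show ?thesis unfolding tip_def by blast
qed

text \<open>Growing along the positive x-axis creates no contact, but old segments in the upper half
  plane may reach far to the right. As a tip must lie beyond all of them, the extension goes up to
  the bound \<open>K\<close>.\<close>

lemma triangle_corner_to_tip_horizontal:
  assumes g: "glued E V ps" "length ps = 3" and c: "clean_corner E V (hd ps) (last ps)"
  shows "tip E (V \<union> set ps) (ps ! 1) (ps ! 2)"
proof -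
  obtain s h w where s: "draws E V s" "s (hd ps) = Box 0 0 0 h" "s (last ps) = Box w 0 0 0"
    and oth: "\<And>v. v \<in> V - {hd ps, last ps} \<Longrightarrow> 0 < yl (s v) \<or> yl (s v) = 0 \<and> xr (s v) < 0"
    using c unfolding clean_corner_def by blast
  note nth = triangle_nth[OF g]
  have seg: "is_seg (s v)" if "v \<in> V" for v using s that by (auto simp: draws_def)
  have hw: "0 \<le> h" "w \<le> 0" using seg[of "hd ps"] seg[of "last ps"] s nth by (auto simp: is_seg_def)
  obtain K where K: "0 < K" "\<And>v. v \<in> V \<Longrightarrow> xr (s v) < K"
    using ex_right_bound g unfolding glued_def by blast
  obtain t where t: "draws E (V \<union> set ps) t" "t (ps ! 0) = Box 0 0 0 h" "t (ps ! 1) = Box 0 K 0 0"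
    "t (ps ! 2) = Box w K 0 0" "\<And>v. v \<in> V - {hd ps, last ps} \<Longrightarrow> t v = s v"
  proof (rule draws_triangle[OF g s(1), of "Box 0 0 0 h" "Box w K 0 0" "Box 0 K 0 0"])
    show "\<not> meets (Box 0 K 0 0) (s v)" if "v \<in> V - {hd ps, last ps}" for v
      using oth[OF that] by (auto simp: meets_def)
    show "meets (Box w K 0 0) (s v) = meets (s (last ps)) (s v)" if "v \<in> V - {hd ps, last ps}" for v
      using oth[OF that] seg[of v] that K(1) by (auto simp: meets_def is_seg_def s)
  qed (use hw s K(1) in \<open>auto simp: is_seg_def meets_def\<close>)
  define m where "m = (\<lambda>b. Box (xl b - K) (xr b - K) (yl b) (yr b))"
  have "draws E (V \<union> set ps) (\<lambda>v. m (t v))"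
    by (rule draws_map[OF t(1)]) (auto simp: m_def is_seg_def meets_def)
  moreover have "m (t (ps ! 1)) = Box (-K) 0 0 0" "m (t (ps ! 2)) = Box (w-K) 0 0 0"
    using t by (auto simp: m_def)
  moreover have "xr (m (t v)) < 0" if v: "v \<in> V \<union> set ps - {ps ! 1, ps ! 2}" for v
  proof (cases "v = ps ! 0")
    case True then show ?thesis using t K by (simp add: m_def)
  next
    case False
    then have "v \<in> V - {hd ps, last ps}" using v nth by auto
    then show ?thesis using t(5)[of v] K(2)[of v] by (auto simp: m_def)
  qed
  ultimately show ?thesis unfolding tip_def by blast
qed

text \<open>Both drawings use the free space right of the tip. With the new vertex as a point at the
  tip, a quarter turn yields a corner; letting it and \<open>ps ! 0\<close> protrude by 1 leaves
  \<open>ps ! 2\<close> behind and yields a tip again.\<close>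

lemma triangle_tip:
  assumes g: "glued E V ps" "length ps = 3" and c: "tip E V (hd ps) (last ps)"
  shows "corner E (V \<union> set ps) (ps ! 0) (ps ! 1)" "tip E (V \<union> set ps) (ps ! 0) (ps ! 1)"
proof -
  obtain s w w' where s: "draws E V s" "s (hd ps) = Box w 0 0 0" "s (last ps) = Box w' 0 0 0"
    and oth: "\<And>v. v \<in> V - {hd ps, last ps} \<Longrightarrow> xr (s v) < 0"
    using c unfolding tip_def by blast
  note nth = triangle_nth[OF g]
  have seg: "is_seg (s v)" if "v \<in> V" for v using s that by (auto simp: draws_def)
  have hw: "w \<le> 0" "w' \<le> 0" using seg[of "hd ps"] seg[of "last ps"] s nth by (auto simp: is_seg_def)
  show "corner E (V \<union> set ps) (ps ! 0) (ps ! 1)"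
  proof -
    obtain t where t: "draws E (V \<union> set ps) t" "t (ps ! 0) = Box w 0 0 0" "t (ps ! 1) = Box 0 0 0 0"
      "t (ps ! 2) = Box w' 0 0 0" "\<And>v. v \<in> V - {hd ps, last ps} \<Longrightarrow> t v = s v"
    proof (rule draws_triangle[OF g s(1), of "Box w 0 0 0" "Box w' 0 0 0" "Box 0 0 0 0"])
      show "\<not> meets (Box 0 0 0 0) (s v)" if "v \<in> V - {hd ps, last ps}" for v
        using oth[OF that] by (auto simp: meets_def)
    qed (use hw s in \<open>auto simp: is_seg_def meets_def\<close>)
    define m where "m = (\<lambda>b. Box (yl b) (yr b) (- xr b) (- xl b))"
    have "draws E (V \<union> set ps) (\<lambda>v. m (t v))"
      by (rule draws_map[OF t(1)]) (auto simp: m_def is_seg_def meets_def)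
    moreover have "m (t (ps ! 0)) = Box 0 0 0 (-w)" "m (t (ps ! 1)) = Box 0 0 0 0"
      using t by (auto simp: m_def)
    moreover have "0 < yl (m (t v)) \<or> yl (m (t v)) = 0 \<and> xr (m (t v)) \<le> 0"
      if v: "v \<in> V \<union> set ps - {ps ! 0, ps ! 1}" for v
    proof (cases "v = ps ! 2")
      case True then show ?thesis using t by (simp add: m_def)
    next
      case False
      then have "v \<in> V - {hd ps, last ps}" using v nth by auto
      then show ?thesis using t(5)[of v] oth[of v] by (auto simp: m_def)
    qed
    ultimately show ?thesis unfolding corner_def by blast
  qed
  show "tip E (V \<union> set ps) (ps ! 0) (ps ! 1)"
  proof -
    obtain t where t: "draws E (V \<union> set ps) t" "t (ps ! 0) = Box w 1 0 0" "t (ps ! 1) = Box 0 1 0 0"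
      "t (ps ! 2) = Box w' 0 0 0" "\<And>v. v \<in> V - {hd ps, last ps} \<Longrightarrow> t v = s v"
    proof (rule draws_triangle[OF g s(1), of "Box w 1 0 0" "Box w' 0 0 0" "Box 0 1 0 0"])
      show "\<not> meets (Box 0 1 0 0) (s v)" if "v \<in> V - {hd ps, last ps}" for v
        using oth[OF that] by (auto simp: meets_def)
      show "meets (Box w 1 0 0) (s v) = meets (s (hd ps)) (s v)" if "v \<in> V - {hd ps, last ps}" for v
        using oth[OF that] seg[of v] that by (auto simp: meets_def is_seg_def s)
    qed (use hw s in \<open>auto simp: is_seg_def meets_def\<close>)
    define m where "m = (\<lambda>b. Box (xl b - 1) (xr b - 1) (yl b) (yr b))"
    have "draws E (V \<union> set ps) (\<lambda>v. m (t v))"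
      by (rule draws_map[OF t(1)]) (auto simp: m_def is_seg_def meets_def)
    moreover have "m (t (ps ! 0)) = Box (w-1) 0 0 0" "m (t (ps ! 1)) = Box (-1) 0 0 0"
      using t by (auto simp: m_def)
    moreover have "xr (m (t v)) < 0" if v: "v \<in> V \<union> set ps - {ps ! 0, ps ! 1}" for v
    proof (cases "v = ps ! 2")
      case True then show ?thesis using t by (simp add: m_def)
    next
      case False
      then have "v \<in> V - {hd ps, last ps}" using v nth by auto
      then show ?thesis using t(5)[of v] oth[of v] by (auto simp: m_def)
    qed
    ultimately show ?thesis unfolding tip_def by blast
  qed
qed

text \<open>
  One drawing does not suffice: which normal form is needed depends on whether the next face is a
  triangle, which is not known yet. So two drawings are maintained.
\<close>

definition extendable :: "('a \<Rightarrow> 'a \<Rightarrow> bool) \<Rightarrow> 'a set \<Rightarrow> 'a \<Rightarrow> 'a \<Rightarrow> bool" where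
  "extendable E V a b \<longleftrightarrow> (corner E V a b \<or> corner E V b a) \<and>
     (clean_corner E V a b \<or> clean_corner E V b a \<or> tip E V a b)"

lemma extendable_commute: "extendable E V a b \<Longrightarrow> extendable E V b a"
  unfolding extendable_def by (metis tip_commute)

text \<open>After a triangle it is the tip, not a clean corner, that fulfils the second half of
  \<open>extendable\<close>. All three starting forms lead to a corner and a tip for the first new
  edge.\<close>

lemma extendable_triangle:
  assumes g: "glued E V ps" "length ps = 3" and e: "extendable E V (hd ps) (last ps)"
  shows "extendable E (V \<union> set ps) (ps ! 0) (ps ! 1)"
proof -
  have g': "glued E V (rev ps)" "length (rev ps) = 3" using g glued_rev by auto
  have r: "hd (rev ps) = last ps" "last (rev ps) = hd ps" "set (rev ps) = set ps"
    using g by (auto simp: hd_rev last_rev)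
  have n: "rev ps ! 0 = ps ! 2" "rev ps ! 1 = ps ! 1" "rev ps ! 2 = ps ! 0"
    using g(2) by (auto simp: rev_nth)
  note rest = triangle_corner_to_corner[OF g'] triangle_corner_to_tip_horizontal[OF g']
  from e consider "clean_corner E V (hd ps) (last ps)" | "clean_corner E V (last ps) (hd ps)"
    | "tip E V (hd ps) (last ps)"
    unfolding extendable_def by blast
  then show ?thesis
  proof cases
    case 1
    then show ?thesis
      using triangle_corner_to_corner[OF g] triangle_corner_to_tip_vertical[OF g]
      unfolding extendable_def by blast
  next
    case 2
    then have "corner E (V \<union> set ps) (ps ! 1) (ps ! 0)" "tip E (V \<union> set ps) (ps ! 1) (ps ! 0)"
      using rest unfolding r n by blast+
    then show ?thesis unfolding extendable_def by (metis tip_commute)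
  next
    case 3
    then show ?thesis using triangle_tip[OF g] unfolding extendable_def by blast
  qed
qed

text \<open>A face with at least four vertices starts from any corner and produces a clean one,
  which fulfils both halves of \<open>extendable\<close>. For a triangle, reversal reduces the
  second new edge to the first.\<close>

lemma extendable_glue:
  assumes g: "glued E V ps" and e: "extendable E V (hd ps) (last ps)" and i: "Suc i < length ps"
  shows "extendable E (V \<union> set ps) (ps ! i) (ps ! Suc i)"
proof -
  have g': "glued E V (rev ps)" using g glued_rev by auto
  have l3: "3 \<le> length ps" and ne: "ps \<noteq> []" using g by (auto simp: glued_def induced_cycle_def)
  have r: "hd (rev ps) = last ps" "last (rev ps) = hd ps" "set (rev ps) = set ps"
    using ne by (auto simp: hd_rev last_rev)
  show ?thesis
  proof (cases "length ps = 3")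
    case True
    show ?thesis
    proof (cases "i = 0")
      case True
      then show ?thesis using extendable_triangle[OF g \<open>length ps = 3\<close> e] by simp
    next
      case False
      then have "i = 1" using i True by simp
      moreover have "extendable E (V \<union> set ps) (rev ps ! 0) (rev ps ! 1)"
        using extendable_triangle[OF g'] True extendable_commute[OF e] unfolding r by simp
      ultimately show ?thesis using True extendable_commute by (simp add: rev_nth numeral_2_eq_2)
    qed
  next
    case False
    then have l: "4 \<le> length ps" using l3 by simp
    from e consider "corner E V (hd ps) (last ps)" | "corner E V (last ps) (hd ps)"
      unfolding extendable_def by blast
    then have "clean_corner E (V \<union> set ps) (ps ! i) (ps ! Suc i) \<or> clean_corner E (V \<union> set ps) (ps ! Suc i) (ps ! i)"
    proof cases
      case 1
      then show ?thesis using big_face[OF g l _ i] by blast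
    next
      case 2
      \<comment> \<open>The position in \<open>rev ps\<close> of the edge between entries
        \<open>i\<close> and \<open>Suc i\<close> of \<open>ps\<close>.\<close>
      define k where "k = length ps - Suc (Suc i)"
      have "Suc k < length (rev ps)" "rev ps ! k = ps ! Suc i" "rev ps ! Suc k = ps ! i"
        using i by (auto simp: k_def rev_nth intro!: arg_cong[of _ _ "(!) ps"])
      then show ?thesis using big_face[OF g', of k] 2 l unfolding r by auto
    qed
    then show ?thesis unfolding extendable_def by (metis clean_corner_imp_corner)
  qed
qed

lemma strip_draws:
  assumes "strip E V a b" "symp E"
  obtains s where "draws E V s"
proof -
  from assms have "finite V \<and> extendable E V a b"
  proof (induction rule: strip.induct)
    case (edge a b)
    \<comment> \<open>An edge is the same point twice, which is a clean corner with both lengths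
      0.\<close>
    then have "draws E {a, b} (\<lambda>_. Box 0 0 0 0)"
      by (auto simp: draws_def is_seg_def meets_def dest: sympD)
    then have "clean_corner E {a, b} a b" unfolding clean_corner_def by auto
    then show ?case using clean_corner_imp_corner[of E "{a, b}" a b] unfolding extendable_def by auto
  next
    case (flip V a b)
    then show ?case by (metis extendable_commute)
  next
    case (glue V a b ps i)
    have "glued E V ps" unfolding glued_def using glue by blast
    then show ?case using extendable_glue[of E V ps i] glue by simp
  qed
  then show ?thesis using that unfolding extendable_def corner_def by blast
qed

section \<open>From boxes to segments in the plane\<close>

definition region :: "box \<Rightarrow> complex set" where
  "region b = {z. xl b \<le> Re z \<and> Re z \<le> xr b \<and> yl b \<le> Im z \<and> Im z \<le> yr b}"

lemma axis_parallel_region: assumes "is_seg b" shows "axis_parallel_segment (region b)"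
proof -
  let ?p = "Complex (xl b) (yl b)" and ?q = "Complex (xr b) (yr b)"
  have "region b = closed_segment ?p ?q \<and> (Re ?p = Re ?q \<or> Im ?p = Im ?q)"
  proof (cases "xl b = xr b")
    case True
    then have "closed_segment ?p ?q = {z. Re z = xl b \<and> Im z \<in> {yl b..yr b}}"
      using closed_segment_same_Re[of ?p ?q] assms
        by (simp add: closed_segment_eq_real_ivl is_seg_def)
    also have "\<dots> = region b" using True by (auto simp: region_def)
    finally show ?thesis using True by simp
  next
    case False
    then have y: "yl b = yr b" using assms by (auto simp: is_seg_def)
    then have "closed_segment ?p ?q = {z. Im z = yl b \<and> Re z \<in> {xl b..xr b}}"
      using closed_segment_same_Im[of ?p ?q] assms
        by (simp add: closed_segment_eq_real_ivl is_seg_def)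
    also have "\<dots> = region b" using y by (auto simp: region_def)
    finally show ?thesis using y by simp
  qed
  then show ?thesis unfolding axis_parallel_segment_def by blast
qed

lemma region_Int:
  assumes "is_seg b" "is_seg b'"
  shows "region b \<inter> region b' \<noteq> {} \<longleftrightarrow> meets b b'"
proof
  assume "meets b b'"
  then have "Complex (max (xl b) (xl b')) (max (yl b) (yl b')) \<in> region b \<inter> region b'"
    using assms by (auto simp: region_def meets_def is_seg_def)
  then show "region b \<inter> region b' \<noteq> {}" by blast
qed (auto simp: region_def meets_def)

lemma draws_B0_VPG:
  assumes "draws (\<lambda>u v. (u, v) \<in> parcs G) (pverts G) s"
  shows "B0_VPG G"
  unfolding B0_VPG_def
proof (intro exI[of _ "\<lambda>v. region (s v)"] conjI ballI impI)
  show "axis_parallel_segment (region (s v))" if "v \<in> pverts G" for v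
    using assms that by (auto simp: draws_def intro: axis_parallel_region)
  show "(u, v) \<in> parcs G \<longleftrightarrow> region (s u) \<inter> region (s v) \<noteq> {}"
    if "u \<in> pverts G" "v \<in> pverts G" "u \<noteq> v" for u v
    using assms that region_Int unfolding draws_def by blast
qed

lemma complete_B0_VPG:
  assumes "\<And>u v. u \<in> pverts G \<Longrightarrow> v \<in> pverts G \<Longrightarrow> u \<noteq> v \<Longrightarrow> (u, v) \<in> parcs G"
  shows "B0_VPG G"
  by (rule draws_B0_VPG[of _ "\<lambda>_. Box 0 0 0 0"]) (auto simp: draws_def is_seg_def meets_def assms)

section \<open>Graphs with a Hamiltonian cycle\<close>

definition share_edge :: "('a \<Rightarrow> 'a \<Rightarrow> bool) \<Rightarrow> 'a list \<Rightarrow> 'a list \<Rightarrow> bool" where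
  "share_edge E C D \<longleftrightarrow> (\<exists>u \<in> set C \<inter> set D. \<exists>v \<in> set C \<inter> set D. E u v)"

text \<open>Many lists describe the same cycle, by rotation and reversal. An induced cycle is
  determined by its vertex set, so distinctness is required of these sets.\<close>

definition three_neighbours :: "('a \<Rightarrow> 'a \<Rightarrow> bool) \<Rightarrow> bool" where
  "three_neighbours E \<longleftrightarrow> (\<exists>D Ds. induced_cycle E D \<and> length Ds = 3 \<and> distinct (map set (D # Ds)) \<and>
     (\<forall>C \<in> set Ds. induced_cycle E C \<and> share_edge E D C))"

definition is_path :: "('a \<Rightarrow> 'a \<Rightarrow> bool) \<Rightarrow> 'a list \<Rightarrow> bool" where
  "is_path E xs \<longleftrightarrow> distinct xs \<and> successively E xs"

text \<open>Equivalently, a subdivision of the complete bipartite graph with parts of sizes 2 and 3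
  occurs as a subgraph.\<close>

definition theta :: "('a \<Rightarrow> 'a \<Rightarrow> bool) \<Rightarrow> bool" where
  "theta E \<longleftrightarrow> (\<exists>x y xs ys zs. xs \<noteq> [] \<and> ys \<noteq> [] \<and> zs \<noteq> [] \<and>
     is_path E (x # xs @ [y]) \<and> is_path E (x # ys @ [y]) \<and> is_path E (x # zs @ [y]) \<and>
     set xs \<inter> set ys = {} \<and> set xs \<inter> set zs = {} \<and> set ys \<inter> set zs = {})"

lemma strip_ends: "strip E V a b \<Longrightarrow> a \<in> V \<and> b \<in> V"
  by (induction rule: strip.induct) (auto simp: nth_mem)

section \<open>Faces on one side of a chord\<close>

lemma list_bracket:
  fixes ps :: "nat list"
  assumes "ps \<noteq> []" "hd ps \<le> x" "x < last ps"
  obtains s where "Suc s < length ps" "ps ! s \<le> x" "x < ps ! Suc s"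
proof -
  have "\<exists>k < length ps - 1. (\<forall>i \<le> k. \<not> x < ps ! i) \<and> x < ps ! Suc k"
    by (rule ex_least_nat_less) (use assms in \<open>auto simp: hd_conv_nth last_conv_nth\<close>)
  then obtain k where "k < length ps - 1" "\<forall>i \<le> k. \<not> x < ps ! i" "x < ps ! Suc k" by blast
  then show ?thesis by (intro that[of k]) auto
qed

text \<open>Together with the edge from \<open>lo\<close> to \<open>hi\<close> such a path bounds the face on its side of that edge.\<close>

definition face_path :: "(nat \<Rightarrow> nat \<Rightarrow> bool) \<Rightarrow> nat \<Rightarrow> nat \<Rightarrow> nat list \<Rightarrow> bool" where
  "face_path E lo hi ps \<longleftrightarrow> sorted_wrt (<) ps \<and> 3 \<le> length ps \<and> hd ps = lo \<and> last ps = hi \<and>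
     (\<forall>i j. i < j \<longrightarrow> j < length ps \<longrightarrow> \<not> (i = 0 \<and> j = length ps - 1) \<longrightarrow>
        (E (ps ! i) (ps ! j) \<longleftrightarrow> j = Suc i))"

text \<open>Take a shortest increasing path from \<open>lo\<close> to \<open>hi\<close> with at
  least three vertices. An edge between two entries that are not consecutive would give a shortcut,
  and the shortcut still has three vertices unless that edge joins \<open>lo\<close> to
  \<open>hi\<close>.\<close>

lemma ex_face_path:
  assumes "Suc lo < hi" and E: "\<And>i. lo \<le> i \<Longrightarrow> i < hi \<Longrightarrow> E i (Suc i)"
  obtains ps where "face_path E lo hi ps"
proof -
  define P where "P ps \<longleftrightarrow> sorted_wrt (<) ps \<and> hd ps = lo \<and> last ps = hi \<and> 3 \<le> length ps \<and> successively E ps" for ps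
  have "P [lo..<Suc hi]"
    using assms unfolding P_def by (auto simp: successively_conv_nth simp del: upt_Suc)
  from ex_has_least_nat[of P, OF this, of length]
  obtain ps where ps: "P ps" and min: "\<And>qs. P qs \<Longrightarrow> length ps \<le> length qs" by blast
  have "E (ps ! i) (ps ! j) \<longleftrightarrow> j = Suc i"
    if ij: "i < j" "j < length ps" "\<not> (i = 0 \<and> j = length ps - 1)" for i j
  proof
    assume "j = Suc i"
    then show "E (ps ! i) (ps ! j)" using ps ij by (auto simp: P_def successively_conv_nth)
  next
    assume e: "E (ps ! i) (ps ! j)"
    show "j = Suc i"
    proof (rule ccontr)
      assume "j \<noteq> Suc i"
      let ?qs = "take (Suc i) ps @ drop j ps"
      have ne: "drop j ps \<noteq> []" "take (Suc i) ps \<noteq> []" using ij by auto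
      have "last (take (Suc i) ps) = ps ! i" "hd (drop j ps) = ps ! j"
        using ij by (auto simp: take_Suc_conv_app_nth hd_drop_conv_nth)
      moreover have "sorted_wrt (<) (take (Suc i) ps @ drop (Suc i) ps)"
        "successively E (take (Suc i) ps @ drop (Suc i) ps)"
        "successively E (take j ps @ drop j ps)"
        using ps by (auto simp: P_def)
      moreover have "set (drop j ps) \<subseteq> set (drop (Suc i) ps)" using ij
        by (intro set_drop_subset_set_drop) auto
      moreover have "sorted_wrt (<) (drop j ps)" using ps by (auto simp: P_def sorted_wrt_drop)
      ultimately have "sorted_wrt (<) ?qs" "successively E ?qs"
        using e ne unfolding sorted_wrt_append successively_append_iff by auto
      moreover have "hd ?qs = lo" "last ?qs = hi" using ps ne ij by (auto simp: P_def)
      moreover have "3 \<le> length ?qs" "length ?qs < length ps" using ij \<open>j \<noteq> Suc i\<close> by auto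
      ultimately show False using min[of ?qs] by (auto simp: P_def)
    qed
  qed
  then show ?thesis using ps that unfolding face_path_def P_def by blast
qed

lemma face_path_mono:
  assumes "face_path E lo hi ps" "i \<le> j" "j < length ps"
  shows "ps ! i \<le> ps ! j" "i < j \<Longrightarrow> ps ! i < ps ! j"
  using assms by (auto simp: face_path_def sorted_wrt_iff_nth_less le_less)

lemma face_path_ends:
  assumes "face_path E lo hi ps"
  shows "ps \<noteq> []" "ps ! 0 = lo" "ps ! (length ps - 1) = hi" "lo \<in> set ps" "hi \<in> set ps"
    "set ps \<subseteq> {lo..hi}"
    "distinct ps" "\<exists>x \<in> set ps. lo < x \<and> x < hi"
proof -
  show ne: "ps \<noteq> []" using assms by (auto simp: face_path_def)
  then show e: "ps ! 0 = lo" "ps ! (length ps - 1) = hi"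
    using assms by (auto simp: face_path_def hd_conv_nth last_conv_nth)
  show "lo \<in> set ps" "hi \<in> set ps" using ne assms by (auto simp: face_path_def)
  show "set ps \<subseteq> {lo..hi}"
    using face_path_mono(1)[OF assms] e by (force simp: in_set_conv_nth)
  show "distinct ps" using assms by (simp add: face_path_def strict_sorted_iff)
  have l: "3 \<le> length ps" using assms by (simp add: face_path_def)
  have "lo < ps ! 1" "ps ! 1 < hi" "ps ! 1 \<in> set ps"
    using face_path_mono(2)[OF assms, of 0 1] face_path_mono(2)[OF assms, of 1 "length ps - 1"] e l
      by auto
  then show "\<exists>x \<in> set ps. lo < x \<and> x < hi" by blast
qed

lemma face_path_edge:
  assumes "face_path E lo hi ps" "Suc t < length ps"
  shows "E (ps ! t) (ps ! Suc t)"
proof -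
  have "\<not> (t = 0 \<and> Suc t = length ps - 1)" using assms by (auto simp: face_path_def)
  then show ?thesis using assms unfolding face_path_def by blast
qed

lemma induced_cycle_face_path:
  assumes "face_path E lo hi ps" "E lo hi"
  shows "induced_cycle E ps"
  unfolding induced_cycle_def
  using assms face_path_ends[OF assms(1)] unfolding face_path_def by (metis)

text \<open>A block is the interval between consecutive entries of \<open>ps\<close>. If the ends of
  the edge were in different blocks, it would cross the edge of \<open>ps\<close> over one of these
  blocks, or join two entries that are not consecutive, which \<open>face_path\<close>
  forbids.\<close>

lemma edge_in_block:
  assumes f: "face_path E lo hi ps"
    and nc: "\<forall>i k j l. lo \<le> i \<and> i < k \<and> k < j \<and> j < l \<and> l \<le> hi \<and> E i j \<longrightarrow> \<not> E k l"
    and xy: "E x y" "lo \<le> x" "x < y" "y \<le> hi" "(x, y) \<noteq> (lo, hi)"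
  obtains t where "Suc t < length ps" "ps ! t \<le> x" "y \<le> ps ! Suc t"
proof -
  note e = face_path_ends[OF f] and m = face_path_mono[OF f]
  have ps: "hd ps = lo" "last ps = hi" using f by (auto simp: face_path_def)
  obtain s where s: "Suc s < length ps" "ps ! s \<le> x" "x < ps ! Suc s"
    using list_bracket[of ps x] e(1) ps xy by auto
  \<comment> \<open>\<open>list_bracket\<close> yields half-open blocks, whereas \<open>y\<close>
    may be the right end of its block; so \<open>y - 1\<close> is located instead.\<close>
  have y1: "lo \<le> y - 1" "y - 1 < hi" using xy by linarith+
  obtain t where t: "Suc t < length ps" "ps ! t \<le> y - 1" "y - 1 < ps ! Suc t"
    using list_bracket[OF e(1), of "y - 1"] ps y1 by auto
  have st: "s \<le> t"
  proof (rule ccontr)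
    assume "\<not> s \<le> t"
    then have "ps ! Suc t \<le> ps ! s" using m(1)[of "Suc t" s] s by simp
    then show False using s t xy by linarith
  qed
  have "s = t"
  proof (rule ccontr)
    assume "s \<noteq> t"
    then have mid: "ps ! Suc s \<le> ps ! t" using m(1)[of "Suc s" t] st t by simp
    have r: "lo \<le> ps ! s" "ps ! Suc t \<le> hi"
      using e(6) s t by (metis Suc_lessD atLeastAtMost_iff nth_mem subsetD)+
    have "x = ps ! s"
      using nc[THEN spec, THEN spec, THEN spec, THEN spec, of "ps ! s" x
        "ps ! Suc s" y] face_path_edge[OF f s(1)] s t mid xy r by fastforce
    moreover have "y = ps ! Suc t"
      using nc[THEN spec, THEN spec, THEN spec, THEN spec, of x "ps ! t" y
        "ps ! Suc t"] face_path_edge[OF f t(1)] s t mid xy r by fastforce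
    moreover have "\<not> (s = 0 \<and> Suc t = length ps - 1)"
      using xy e calculation by auto
    ultimately show False
      using f xy(1) \<open>s \<noteq> t\<close> st t(1) unfolding face_path_def by (metis le_imp_less_Suc nat.inject)
  qed
  then show ?thesis using that[of t] s t xy by simp
qed

text \<open>\<open>V\<close> is what has been traversed, the chord from \<open>lo\<close> to
  \<open>hi\<close> is the current edge, and \<open>C\<close> is the face just left, which touches
  the interval only in the ends of the chord. After gluing the face on the inner side, at most one
  of its blocks has vertices inside, and the induction continues there with that face in the role of
  \<open>C\<close>.\<close>

lemma strip_polygon:
  fixes E :: "nat \<Rightarrow> nat \<Rightarrow> bool"
  assumes sym: "symp E" and path: "\<And>i. Suc i < n \<Longrightarrow> E i (Suc i)"
    and nc: "\<And>i k j l. i < k \<Longrightarrow> k < j \<Longrightarrow> j < l \<Longrightarrow> l < n \<Longrightarrow> E i j \<Longrightarrow> \<not> E k l"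
    and three: "\<not> three_neighbours E"
  shows "strip E V lo hi \<Longrightarrow> hi < n \<Longrightarrow> Suc lo < hi \<Longrightarrow> E lo hi \<Longrightarrow> V \<inter> {lo<..<hi} = {} \<Longrightarrow>
    (\<And>x v. x \<in> {lo<..<hi} \<Longrightarrow> v \<in> V - {lo, hi} \<Longrightarrow> \<not> E x v) \<Longrightarrow>
    induced_cycle E C \<Longrightarrow> set C \<inter> {lo..hi} = {lo, hi} \<Longrightarrow> \<exists>a b. strip E (V \<union> {lo..hi}) a b"
proof (induction "hi - lo" arbitrary: lo hi V C rule: less_induct)
  case less
  obtain ps where f: "face_path E lo hi ps"
    using ex_face_path[of lo hi E] path less.prems(2,3) by (metis Suc_leI le_less_trans)
  note e = face_path_ends[OF f] and m = face_path_mono[OF f]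
  have ic: "induced_cycle E ps" using induced_cycle_face_path[OF f less.prems(4)] .
  have ps: "hd ps = lo" "last ps = hi" "3 \<le> length ps" using f by (auto simp: face_path_def)
  have V: "lo \<in> V" "hi \<in> V" using strip_ends[OF less.prems(1)] by auto
  have psV: "set ps \<inter> V = {lo, hi}" using e(4-6) V less.prems(5) by force
  have new: "strip E (V \<union> set ps) (ps ! i) (ps ! Suc i)" if "Suc i < length ps" for i
  proof (rule strip.glue[OF less.prems(1) ic ps(1,2) psV _ that])
    fix x v assume "x \<in> set ps - V" "v \<in> V - {lo, hi}"
    moreover from this have "x \<in> {lo<..<hi}" using e(6) V by force
    ultimately show "\<not> E x v" using less.prems(6) by blast
  qed
  have block_le: "lo \<le> ps ! t" "ps ! Suc t \<le> hi" "ps ! t < ps ! Suc t" if "Suc t < length ps" for t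
    using e(6) m(2)[of t "Suc t"] that
      by (metis Suc_lessD atLeastAtMost_iff lessI less_imp_le nth_mem subsetD)+
  have nc': "\<forall>i k j l. lo \<le> i \<and> i < k \<and> k < j \<and> j < l \<and> l \<le> hi \<and> E i j \<longrightarrow> \<not> E k l"
    using nc less.prems(2) by (meson le_less_trans)
  have same_block: "t = t'" if "Suc t < length ps" "Suc t' < length ps" "ps ! t < x" "x < ps ! Suc t"
    "ps ! t' \<le> x" "x \<le> ps ! Suc t'" for t t' x
  proof (rule ccontr)
    assume "t \<noteq> t'"
    then have "Suc t \<le> t' \<or> Suc t' \<le> t" by linarith
    then show False using m(1)[of "Suc t" t'] m(1)[of "Suc t'" t] that by auto
  qed
  have ps_block: "v = ps ! t \<or> v = ps ! Suc t" if v: "v \<in> set ps" "ps ! t \<le> v" "v \<le> ps ! Suc t"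
    and t: "Suc t < length ps" for v t
  proof -
    obtain k where k: "k < length ps" "v = ps ! k" using v by (metis in_set_conv_nth)
    have "k = t \<or> k = Suc t"
      using v(2,3) k m(2)[of k t] m(2)[of "Suc t" k] t
        by (metis Suc_lessD leD le_less_Suc_eq less_le_not_le nat_le_linear not_less_eq)
    then show ?thesis using k by blast
  qed
  show ?case
  proof (cases "\<exists>t. Suc t < length ps \<and> Suc (ps ! t) < ps ! Suc t")
    case False
    have "x \<in> set ps" if "x \<in> {lo..hi}" for x
    proof (cases "x = hi")
      case True then show ?thesis using e by simp
    next
      case 2: False
      then have "lo \<le> x" "x < hi" using that by auto
      then obtain s where s: "Suc s < length ps" "ps ! s \<le> x" "x < ps ! Suc s"
        using list_bracket[OF e(1)] ps by metis
      then have "x = ps ! s" using False by force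
      then show ?thesis using s by simp
    qed
    then have "V \<union> {lo..hi} = V \<union> set ps" using e(6) by auto
    then show ?thesis using new[of 0] ps by force
  next
    case True
    then obtain t where t: "Suc t < length ps" "Suc (ps ! t) < ps ! Suc t" by blast
    \<comment> \<open>Two blocks with vertices inside carry faces \<open>D\<close> and
      \<open>D'\<close>, which together with \<open>C\<close> would be three neighbours of
      \<open>ps\<close>.\<close>
    have only: "t' = t" if t': "Suc t' < length ps" "Suc (ps ! t') < ps ! Suc t'" for t'
    proof (rule ccontr)
      assume ne: "t' \<noteq> t"
      have ex: "\<exists>D. face_path E (ps ! s) (ps ! Suc s) D"
        if "Suc s < length ps" "Suc (ps ! s) < ps ! Suc s" for s
        using ex_face_path[of "ps ! s" "ps ! Suc s" E] path block_le[OF that(1)] less.prems(2) that(2)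
        by (metis Suc_leI le_less_trans le_trans)
      obtain D where D: "face_path E (ps ! t) (ps ! Suc t) D" using ex t by blast
      obtain D' where D': "face_path E (ps ! t') (ps ! Suc t') D'" using ex t' by blast
      note eD = face_path_ends[OF D] and eD' = face_path_ends[OF D']
      have ind: "induced_cycle E D" "induced_cycle E D'"
        using induced_cycle_face_path[OF D] induced_cycle_face_path[OF D'] face_path_edge[OF f] t t'
          by auto
      have sh: "share_edge E ps D" "share_edge E ps D'" "share_edge E ps C"
        unfolding share_edge_def
          using face_path_edge[OF f] t t' eD(4,5) eD'(4,5) e(4,5) less.prems(4,8)
        by (blast dest: Suc_lessD nth_mem)+
      obtain x where x: "x \<in> set D" "ps ! t < x" "x < ps ! Suc t" using eD by blast
      obtain x' where x': "x' \<in> set D'" "ps ! t' < x'" "x' < ps ! Suc t'" using eD' by blast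
      obtain z where z: "z \<in> set ps" "lo < z" "z < hi" using e by blast
      have notC: "y \<notin> set C" if "lo < y" "y < hi" for y
      proof
        assume "y \<in> set C"
        then have "y \<in> set C \<inter> {lo..hi}" using that by simp
        then show False using that unfolding less.prems(8) by simp
      qed
      have "x \<notin> set ps" using ps_block[of x t] x t by auto
      moreover have "x' \<notin> set ps" using ps_block[of x' t'] x' t' by auto
      moreover have "x \<notin> set C" using x block_le[OF t(1)] by (intro notC) linarith+
      moreover have "x' \<notin> set C" using x' block_le[OF t'(1)] by (intro notC) linarith+
      moreover have "z \<notin> set C" using z by (intro notC)
      moreover have "x \<notin> set D'"
      proof
        assume "x \<in> set D'"
        then have "ps ! t' \<le> x" "x \<le> ps ! Suc t'" using eD'(6) by auto
        then show False using same_block[OF t(1) t'(1) x(2,3)] ne by simp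
      qed
      \<comment> \<open>\<open>x\<close> belongs to \<open>D\<close> alone, \<open>x'\<close>
        separates \<open>D'\<close> from \<open>ps\<close> and \<open>C\<close>, and
        \<open>z\<close> separates \<open>ps\<close> from \<open>C\<close>.\<close>
      ultimately have "distinct (map set [ps, C, D, D'])" using x x' z by auto
      then have "three_neighbours E"
        unfolding three_neighbours_def using ind ic sh less.prems(7)
        by (intro exI[of _ ps] exI[of _ "[C, D, D']"]) auto
      then show False using three by blast
    qed
    let ?lo = "ps ! t" and ?hi = "ps ! Suc t"
    have "\<exists>a b. strip E (V \<union> set ps \<union> {?lo..?hi}) a b"
    proof (rule less.hyps[OF _ new[OF t(1)] _ t(2) face_path_edge[OF f t(1)] _ _ ic])
      \<comment> \<open>The interval shrinks because \<open>ps\<close> has at least three entries,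
        so that no block is all of it.\<close>
      have "?lo \<noteq> lo \<or> ?hi \<noteq> hi"
      proof (cases "t = 0")
        case True
        then have "?hi < ps ! (length ps - 1)" using m(2)[of "Suc t" "length ps - 1"] ps by simp
        then show ?thesis using e by simp
      next
        case False
        then have "ps ! 0 < ?lo" using m(2)[of 0 t] t by simp
        then show ?thesis using e by simp
      qed
      then show "?hi - ?lo < hi - lo" using block_le[OF t(1)] by linarith
      show "?hi < n" using block_le[OF t(1)] less.prems(2) by linarith
      show "(V \<union> set ps) \<inter> {?lo<..<?hi} = {}"
      proof (rule equals0I)
        fix y assume y: "y \<in> (V \<union> set ps) \<inter> {?lo<..<?hi}"
        then have "y \<in> {lo<..<hi}" using block_le[OF t(1)] by auto
        then have "y \<in> set ps" using y less.prems(5) by blast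
        then show False using ps_block[of y t] y t(1) by auto
      qed
      show "set ps \<inter> {?lo..?hi} = {?lo, ?hi}"
      proof (intro equalityI subsetI)
        fix y assume "y \<in> set ps \<inter> {?lo..?hi}"
        then show "y \<in> {?lo, ?hi}" using ps_block[of y t] t(1) by auto
      qed (use t(1) block_le(3)[OF t(1)] in auto)
      fix x v assume x: "x \<in> {?lo<..<?hi}" and v: "v \<in> V \<union> set ps - {?lo, ?hi}"
      have x': "x \<in> {lo<..<hi}" using x block_le[OF t(1)] by auto
      show "\<not> E x v"
      proof (cases "v \<in> set ps")
        case False
        then show ?thesis using less.prems(6)[OF x'] v e by auto
      next
        case True
        show ?thesis
        proof
          assume xv: "E x v"
          have vl: "lo \<le> v" "v \<le> hi" using True e by auto
          have out: "\<not> (?lo \<le> v \<and> v \<le> ?hi)" using ps_block[OF True _ _ t(1)] v by blast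
          \<comment> \<open>By \<open>edge_in_block\<close> the edge lies in a single block,
            necessarily the one around \<open>x\<close>; but \<open>v\<close> is outside that
            block.\<close>
          have "E (min x v) (max x v)" using xv sym by (auto simp: min_def max_def dest: sympD)
          moreover have "min x v < max x v" using out x by auto
          moreover have "lo \<le> min x v" "max x v \<le> hi" "(min x v, max x v) \<noteq> (lo, hi)" using vl x'
            by (auto simp: min_def max_def split: if_splits)
          ultimately obtain t' where t': "Suc t' < length ps" "ps ! t' \<le> min x v"
            "max x v \<le> ps ! Suc t'"
            using edge_in_block[where x = "min x v" and y = "max x v", OF f nc'] by blast
          then have "t = t'" using same_block[OF t(1) t'(1)] x by auto
          then show False using t' out by auto
        qed
      qed
    qed
    moreover have "V \<union> set ps \<union> {?lo..?hi} = V \<union> {lo..hi}"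
    proof (intro equalityI subsetI)
      fix x assume x: "x \<in> V \<union> {lo..hi}"
      show "x \<in> V \<union> set ps \<union> {?lo..?hi}"
      proof (cases "x \<in> V \<or> x = hi")
        case True then show ?thesis using V by auto
      next
        case False
        then have "lo \<le> x" "x < hi" using x by auto
        then obtain s where s: "Suc s < length ps" "ps ! s \<le> x" "x < ps ! Suc s"
          using list_bracket[OF e(1)] ps by metis
        show ?thesis
        proof (cases "s = t")
          case True then show ?thesis using s by auto
        next
          case False
          then have "x = ps ! s" using only[of s] s by linarith
          then show ?thesis using s by auto
        qed
      qed
    qed (use e(6) block_le[OF t(1)] in auto)
    ultimately show ?thesis by simp
  qed
qed

text \<open>The conditions on \<open>m\<close> say that 0 and \<open>m\<close>, ...,
  \<open>n - 1\<close> induce a cycle. This is the starting face, glued to its edge between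
  \<open>n - 1\<close> and 0 and left through the edge from 0 to \<open>m\<close>. If
  \<open>m\<close> is 1, this face is the whole graph.\<close>

lemma strip_hamiltonian:
  fixes E :: "nat \<Rightarrow> nat \<Rightarrow> bool"
  assumes sym: "symp E" and path: "\<And>i. Suc i < n \<Longrightarrow> E i (Suc i)" and cyc: "E 0 (n - 1)"
    and nc: "\<And>i k j l. i < k \<Longrightarrow> k < j \<Longrightarrow> j < l \<Longrightarrow> l < n \<Longrightarrow> E i j \<Longrightarrow> \<not> E k l"
    and three: "\<not> three_neighbours E"
    and m: "1 \<le> m" "Suc (Suc m) \<le> n" "E 0 m"
    and ear: "\<And>s t. m \<le> s \<Longrightarrow> s < t \<Longrightarrow> t < n \<Longrightarrow> E s t \<Longrightarrow> t = Suc s"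
      "\<And>t. m < t \<Longrightarrow> Suc t < n \<Longrightarrow> \<not> E 0 t"
  shows "\<exists>a b. strip E {..<n} a b"
proof -
  \<comment> \<open>The descending order makes \<open>n - 1\<close> and 0 the ends of the list and
    places the exit edge from \<open>m\<close> to 0 at its end.\<close>
  define ps where "ps = rev [m..<n] @ [0]"
  have len: "length ps = n - m + 1" using m by (simp add: ps_def)
  have nth: "ps ! i = (if i < n - m then n - 1 - i else 0)" if "i < length ps" for i
    using that m unfolding ps_def by (auto simp: nth_append rev_nth)
  have set: "set ps = insert 0 {m..<n}" by (auto simp: ps_def)
  have ic: "induced_cycle E ps"
    unfolding induced_cycle_def
  proof (intro conjI allI impI)
    show "3 \<le> length ps" "distinct ps" using m by (auto simp: len) (auto simp: ps_def)
    fix i j assume ij: "i < j" "j < length ps"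
    show "E (ps ! i) (ps ! j) \<longleftrightarrow> j = Suc i \<or> i = 0 \<and> j = length ps - 1"
    proof (cases "j < n - m")
      case True
      then have "E (ps ! i) (ps ! j) \<longleftrightarrow> E (n - 1 - j) (n - 1 - i)"
        using nth ij sym by (auto dest: sympD)
      also have "\<dots> \<longleftrightarrow> n - 1 - i = Suc (n - 1 - j)"
        using ear(1)[of "n - 1 - j" "n - 1 - i"] path[of "n - 1 - j"] True ij m by auto
      also have "\<dots> \<longleftrightarrow> j = Suc i \<or> i = 0 \<and> j = length ps - 1"
        using ij True len by auto
      finally show ?thesis .
    next
      case False
      then have j: "j = n - m" "i < n - m" using ij len by auto
      then have "E (ps ! i) (ps ! j) \<longleftrightarrow> E 0 (n - 1 - i)"
        using nth ij sym by (auto dest: sympD)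
      also have "\<dots> \<longleftrightarrow> n - 1 - i = m \<or> i = 0"
      proof (cases "i = 0")
        case False
        then have "n - 1 - i = m \<or> m < n - 1 - i \<and> Suc (n - 1 - i) < n" using j by linarith
        then show ?thesis using ear(2)[of "n - 1 - i"] m(3) False by auto
      qed (use cyc in simp)
      also have "\<dots> \<longleftrightarrow> j = Suc i \<or> i = 0 \<and> j = length ps - 1"
        using j len by auto
      finally show ?thesis .
    qed
  qed
  have "n - 1 \<noteq> 0" using m by simp
  then have "strip E {n - 1, 0} (n - 1) 0" using cyc sym by (intro strip.edge) (auto dest: sympD)
  then have "strip E ({n - 1, 0} \<union> set ps) (ps ! (n - m - 1)) (ps ! Suc (n - m - 1))"
  proof (rule strip.glue[OF _ ic])
    show "hd ps = n - 1" "last ps = 0" using m by (auto simp: ps_def hd_rev)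
    show "set ps \<inter> {n - 1, 0} = {n - 1, 0}" unfolding set using m by auto
  qed (use m len in auto)
  moreover have "ps ! (n - m - 1) = m" "ps ! Suc (n - m - 1) = 0"
    using m len nth[of "n - m - 1"] nth[of "Suc (n - m - 1)"] by auto
  ultimately have "strip E ({n - 1, 0} \<union> set ps) m 0" by simp
  moreover have V: "{n - 1, 0} \<union> set ps = insert 0 {m..<n}" unfolding set using m by auto
  ultimately have st: "strip E (insert 0 {m..<n}) 0 m" using strip.flip by metis
  show ?thesis
  proof (cases "m = 1")
    case True
    then have "insert 0 {m..<n} = {..<n}" using m by auto
    then show ?thesis using st by auto
  next
    case False
    have "\<exists>a b. strip E (insert 0 {m..<n} \<union> {0..m}) a b"
    proof (rule strip_polygon[OF sym path nc three st])
      show "induced_cycle E ps" by (rule ic)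
      show "set ps \<inter> {0..m} = {0, m}" using set m by auto
      \<comment> \<open>Such an edge would cross the chord from 0 to \<open>m\<close>.\<close>
      show "\<not> E x v" if "x \<in> {0<..<m}" "v \<in> insert 0 {m..<n} - {0, m}" for x v
        using nc[of 0 x m v] that m by auto
    qed (use m False in auto)
    moreover have "insert 0 {m..<n} \<union> {0..m} = {..<n}" using m by auto
    ultimately show ?thesis by simp
  qed
qed

section \<open>Two-connectedness and Hamiltonian cycles\<close>

definition two_connected :: "('a \<Rightarrow> 'a \<Rightarrow> bool) \<Rightarrow> 'a set \<Rightarrow> bool" where
  "two_connected E V \<longleftrightarrow> (\<forall>S X. S \<subset> V \<and> card S < 2 \<and> X \<subset> V - S \<and> X \<noteq> {} \<longrightarrow>
     (\<exists>u \<in> X. \<exists>v \<in> V - S - X. E u v))"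

text \<open>A single edge counts as a cycle of length 2, which serves as the start of the ear argument.\<close>

definition cycle :: "('a \<Rightarrow> 'a \<Rightarrow> bool) \<Rightarrow> 'a list \<Rightarrow> bool" where
  "cycle E xs \<longleftrightarrow> 2 \<le> length xs \<and> is_path E xs \<and> E (last xs) (hd xs)"

text \<open>Connectivity is restated in terms of cuts, the form in which the ear argument uses it: a
  walk from \<open>X\<close> to its complement has to use an edge leaving \<open>X\<close>.\<close>

lemma biconnected_two_connected:
  assumes "pair_graph G" "biconnected G"
  shows "two_connected (\<lambda>u v. (u, v) \<in> parcs G) (pverts G)"
  unfolding two_connected_def
proof (intro allI impI, elim conjE)
  fix S X assume S: "S \<subset> pverts G" "card S < 2" and X: "X \<subset> pverts G - S" "X \<noteq> {}"
  let ?W = "pverts G - S"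
  have sym: "(v, u) \<in> parcs G" if "(u, v) \<in> parcs G" for u v
  proof -
    interpret pair_graph G by (rule assms)
    show ?thesis using pair_sym_arcs that by (auto simp: symmetric_def sym_def)
  qed
  have "\<not> separator G S" using assms(2) S(2) unfolding biconnected_def by blast
  then have con: "strongly_connected (mk_symmetric (with_proj G \<restriction> ?W))"
    using S(1) unfolding separator_def connected_def by blast
  obtain u w where u: "u \<in> X" and w: "w \<in> ?W" "w \<notin> X" using X by blast
  have "u \<rightarrow>\<^sup>*\<^bsub>with_proj (mk_symmetric (with_proj G \<restriction> ?W))\<^esub> w"
    using con u w X unfolding strongly_connected_def by auto
  then have r: "(u, w) \<in> rtrancl_on ?W (parcs (mk_symmetric (with_proj G \<restriction> ?W)))"
    unfolding reachable_def by simp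
  show "\<exists>u \<in> X. \<exists>v \<in> ?W - X. (u, v) \<in> parcs G"
  proof (rule ccontr)
    assume no: "\<not> (\<exists>u \<in> X. \<exists>v \<in> ?W - X. (u, v) \<in> parcs G)"
    from r have "w \<in> X"
    proof (induction rule: rtrancl_on_induct)
      case base show ?case by (rule u)
    next
      case (step y z)
      then have "(y, z) \<in> parcs G" using sym by (auto simp: parcs_mk_symmetric)
      then show ?case using step no by blast
    qed
    then show False using w by blast
  qed
qed

text \<open>\<open>R\<close> collects the vertices reachable outside \<open>C\<close> from a
  neighbour \<open>w\<close> of \<open>x\<close>. By the cut condition after deletion of
  \<open>x\<close>, some edge leaves \<open>R\<close> for a vertex \<open>y\<close> other than
  \<open>x\<close>. This \<open>y\<close> belongs to \<open>C\<close>, since otherwise it would be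
  reachable as well.\<close>

lemma ear:
  assumes tc: "two_connected E V" and sym: "symp E" and C: "C \<subset> V" "a \<in> C" "b \<in> C" "a \<noteq> b"
  obtains x y zs where "x \<in> C" "y \<in> C" "x \<noteq> y" "zs \<noteq> []" "is_path E (x # zs @ [y])" "set zs \<subseteq> V - C"
proof -
  obtain x w where xw: "x \<in> C" "w \<in> V - C" "E x w"
    using tc[unfolded two_connected_def, rule_format, of "{}" C] C by auto
  define R where "R = {v. \<exists>qs. qs \<noteq> [] \<and> hd qs = w \<and> last qs = v \<and> is_path E qs \<and> set qs \<subseteq> V - C}"
  have "w \<in> R" unfolding R_def using xw by (auto intro!: exI[of _ "[w]"] simp: is_path_def)
  have RV: "R \<subseteq> V - C" unfolding R_def by (auto dest: last_in_set)
  obtain z where z: "z \<in> C" "z \<noteq> x" using C by blast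
  have "\<exists>u \<in> R. \<exists>v \<in> V - {x} - R. E u v"
    using tc[unfolded two_connected_def, rule_format, of "{x}" R] RV z xw \<open>w \<in> R\<close> C by auto
  then obtain u y where uy: "u \<in> R" "y \<in> V" "y \<noteq> x" "y \<notin> R" "E u y" by blast
  obtain qs where qs: "qs \<noteq> []" "hd qs = w" "last qs = u" "is_path E qs" "set qs \<subseteq> V - C"
    using uy(1) unfolding R_def by blast
  have "y \<in> C"
  proof (rule ccontr)
    assume "y \<notin> C"
    show False
    proof (cases "y \<in> set qs")
      case True
      then obtain as bs where ab: "qs = as @ y # bs" by (meson split_list)
      have "is_path E (as @ [y])" "hd (as @ [y]) = w"
        using qs ab by (auto simp: is_path_def successively_append_iff successively_Cons hd_append)
      then have "y \<in> R" unfolding R_def using qs ab by (auto intro!: exI[of _ "as @ [y]"])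
      then show False using uy by blast
    next
      case False
      then have "is_path E (qs @ [y])" using qs uy by (auto simp: is_path_def successively_append_iff)
      then have "y \<in> R" unfolding R_def using qs uy \<open>y \<notin> C\<close> by (auto intro!: exI[of _ "qs @ [y]"])
      then show False using uy by blast
    qed
  qed
  moreover have "is_path E (x # qs @ [y])"
    using qs uy xw calculation by (auto simp: is_path_def successively_append_iff successively_Cons)
  ultimately show ?thesis using that[of x y qs] xw qs uy by auto
qed

lemma cycle_append_commute: "cycle E (xs @ ys) \<Longrightarrow> cycle E (ys @ xs)"
  by (cases "xs = [] \<or> ys = []")
     (auto simp: cycle_def is_path_def successively_append_iff)

lemma cycle_rotate: "cycle E xs \<Longrightarrow> cycle E (rotate k xs)"
  unfolding rotate_drop_take
    using cycle_append_commute[of E "take (k mod length xs) xs" "drop (k mod length xs) xs"] by simp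

lemma is_path_rev: "symp E \<Longrightarrow> is_path E xs \<Longrightarrow> is_path E (rev xs)"
  by (auto simp: is_path_def elim!: successively_mono dest: sympD)

lemma hamiltonian_cycle:
  assumes tc: "two_connected E V" and sym: "symp E" and fin: "finite V" and V: "2 \<le> card V"
    and E: "\<And>u v. E u v \<Longrightarrow> u \<in> V \<and> v \<in> V \<and> u \<noteq> v" and th: "\<not> theta E"
  obtains vs where "cycle E vs" "set vs = V"
proof -
  define P where "P vs \<longleftrightarrow> cycle E vs \<and> set vs \<subseteq> V" for vs
  obtain a where a: "a \<in> V" using V by fastforce
  have "{a} \<noteq> V" using V by auto
  then obtain b where b: "b \<in> V" "E a b"
    using tc[unfolded two_connected_def, rule_format, of "{}" "{a}"] a by auto
  have "P [a, b]" unfolding P_def cycle_def using a b sym E[OF b(2)]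
    by (auto simp: is_path_def dest: sympD)
  moreover have "\<forall>vs. P vs \<longrightarrow> length vs < Suc (card V)"
  proof (intro allI impI)
    fix vs assume "P vs"
    then have "card (set vs) = length vs" "set vs \<subseteq> V"
      by (auto simp: P_def cycle_def is_path_def distinct_card)
    then show "length vs < Suc (card V)" using card_mono[OF fin, of "set vs"] by simp
  qed
  ultimately obtain vs where vs: "P vs" and max: "\<And>us. P us \<Longrightarrow> length us \<le> length vs"
    using ex_has_greatest_nat[of P "[a, b]" length] by blast
  have "set vs = V"
  proof (rule ccontr)
    assume ne: "set vs \<noteq> V"
    have d: "distinct vs" "2 \<le> length vs" using vs by (auto simp: P_def cycle_def is_path_def)
    then have l: "0 < length vs" "1 < length vs" by auto
    have "vs ! 0 \<noteq> vs ! 1" using nth_eq_iff_index_eq[OF d(1) l] by simp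
    moreover have "set vs \<subset> V" using vs ne unfolding P_def by blast
    ultimately obtain x y zs where xy: "x \<in> set vs" "y \<in> set vs" "x \<noteq> y" "zs \<noteq> []"
      "is_path E (x # zs @ [y])" "set zs \<subseteq> V - set vs"
      using ear[OF tc sym _ nth_mem[OF l(1)] nth_mem[OF l(2)]] by blast
    \<comment> \<open>Rotated to begin at \<open>x\<close>, the cycle reads
      \<open>x # cs @ y # ds\<close>, so \<open>cs\<close> and \<open>ds\<close> are the interiors
      of its two arcs between the feet of the ear.\<close>
    obtain as bs where ab: "vs = as @ x # bs" using xy(1) by (meson split_list)
    have "y \<in> set (bs @ as)" using xy(2,3) ab by auto
    then obtain cs ds where cd: "bs @ as = cs @ y # ds" by (meson split_list)
    have len: "length vs = Suc (Suc (length cs + length ds))"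
      and set: "set vs = {x, y} \<union> set cs \<union> set ds"
    proof -
      have "length (bs @ as) = length (cs @ y # ds)" "set (bs @ as) = set (cs @ y # ds)"
        by (simp_all only: cd)
      then show "length vs = Suc (Suc (length cs + length ds))" "set vs = {x, y} \<union> set cs \<union> set ds"
        unfolding ab by auto
    qed
    have sub: "set vs \<subseteq> V" using vs unfolding P_def by blast
    have "cycle E (as @ (x # bs))" using vs ab unfolding P_def by simp
    then have "cycle E ((x # bs) @ as)" by (rule cycle_append_commute)
    then have cyc: "cycle E (x # cs @ y # ds)" using cd by simp
    have z: "E x (hd zs)" "E (last zs) y" "successively E zs" "distinct zs"
      "set zs \<inter> ({x, y} \<union> set cs \<union> set ds) = {}"
      using xy set by (auto simp: is_path_def successively_append_iff successively_Cons)
    have sE: "successively (\<lambda>x y. E y x) zs" "E (hd zs) x" "E y (last zs)"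
      using z(1-3) sym by (auto elim!: successively_mono dest: sympD)
    show False
    proof (cases "cs = []")
      case True
      \<comment> \<open>With nothing between \<open>x\<close> and \<open>y\<close> on this side, the
        ear replaces the edge joining them and lengthens the cycle.\<close>
      have "cycle E (x # zs @ y # ds)"
        using cyc True z xy(4)
          by (auto simp: cycle_def is_path_def successively_append_iff successively_Cons)
      then have "P (x # zs @ y # ds)" using xy(6) sub unfolding P_def set by auto
      then show False using max[of "x # zs @ y # ds"] len True xy(4) by (cases zs) auto
    next
      case cs: False
      show False
      proof (cases "ds = []")
        case True
        have "cycle E (x # cs @ y # rev zs)"
          using cyc True z sE xy(4) cs
          by (auto simp: cycle_def is_path_def successively_append_iff successively_Cons last_rev
            hd_rev)
        then have "P (x # cs @ y # rev zs)" using xy(6) sub unfolding P_def set by auto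
        then show False using max[of "x # cs @ y # rev zs"] len True xy(4) by (cases zs) auto
      next
        case False
        have cp: "distinct (x # cs @ y # ds)" "successively E (x # cs @ [y])"
          "successively E (y # ds)" "E (last ds) x"
          using cyc False cs by (auto simp: cycle_def is_path_def successively_append_iff
            successively_Cons)
        have "is_path E (y # ds @ [x])"
          using cp False by (auto simp: is_path_def successively_append_iff successively_Cons)
        then have "is_path E (rev (y # ds @ [x]))" by (rule is_path_rev[OF sym])
        then have "is_path E (x # rev ds @ [y])" by simp
        moreover have "is_path E (x # cs @ [y])" using cp by (auto simp: is_path_def)
        ultimately have "theta E"
          unfolding theta_def using xy(4,5) cs False cp(1) z(5)
          by (intro exI[of _ x] exI[of _ y] exI[of _ cs] exI[of _ "rev ds"] exI[of _ zs]) auto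
        then show False using th by blast
      qed
    qed
  qed
  then show ?thesis using that vs unfolding P_def by blast
qed

lemma successively_upt:
  assumes "\<And>i. a \<le> i \<Longrightarrow> Suc i < b \<Longrightarrow> E i (Suc i)"
  shows "successively E [a..<b]"
  using assms by (auto simp: successively_conv_nth)

text \<open>
  Two crossing chords and a fifth vertex on the cycle form a theta. The case of four vertices, where the
  graph is complete, is a genuine exception.
\<close>

lemma hamiltonian_noncrossing:
  fixes E :: "nat \<Rightarrow> nat \<Rightarrow> bool"
  assumes sym: "symp E" and path: "\<And>i. Suc i < n \<Longrightarrow> E i (Suc i)" and cyc: "E 0 (n - 1)"
    and th: "\<not> theta E" and n: "5 \<le> n"
    and ord: "i < k" "k < j" "j < l" "l < n" and ij: "E i j"
  shows "\<not> E k l"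
proof
  assume kl: "E k l"
  have E: "E x y \<longleftrightarrow> E y x" for x y using sym by (auto dest: sympD)
  have up: "successively E [a..<b]" if "b \<le> n" for a b using that
    by (intro successively_upt path) auto
  have dn: "successively (\<lambda>x y. E y x) [a..<b]" if "b \<le> n" for a b
    using up[OF that, of a] E by (auto elim!: successively_mono)
  have step: "E a (Suc a)" "E (Suc a) a" if "Suc a < n" for a using path[OF that] E by auto
  have step': "E (a - Suc 0) a" "E a (a - Suc 0)" if "0 < a" "a < n" for a
    using step[of "a - 1"] that by auto
  have nxt: "E a b" "E b a" if "a < b" "b \<le> Suc a" "b < n" for a b
    using step[of a] that by (auto simp: le_Suc_eq)
  have wrap: "E 0 (n - Suc 0)" "E (n - Suc 0) 0" using cyc E by auto
  have wrap': "E 0 l" "E l 0" if "\<not> Suc l < n"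
  proof -
    have "l = n - Suc 0" using that ord by simp
    then show "E 0 l" "E l 0" using wrap by simp_all
  qed
  note simps = is_path_def successively_append_iff successively_Cons hd_rev last_rev hd_append
    last_append
    up dn step step' nxt wrap wrap' ij kl
  have sy: "E j i" "E l k" using ij kl E by auto
  \<comment> \<open>A fifth vertex lies in one of the four arcs into which the ends of the chords
    cut the cycle. The theta joins the two ends of that arc: one path is the arc itself, and each of
    the others uses one chord and a neighbouring arc.\<close>
  have "i + 1 < k \<or> k + 1 < j \<or> j + 1 < l \<or> 0 < i \<or> l + 1 < n" using n ord by linarith
  then consider "i + 1 < k" | "k + 1 < j" | "j + 1 < l" | "0 < i \<or> l + 1 < n" by blast
  then have "theta E"
  proof cases
    case 1
    have "is_path E (i # [Suc i..<k] @ [k])" using 1 ord by (auto simp: simps)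
    moreover have "is_path E (i # (j # rev [Suc k..<j]) @ [k])" using ord
      by (cases "Suc k < j"; auto simp: simps)
    moreover have "is_path E (i # (rev [0..<i] @ rev [l..<n]) @ [k])" using ord sy
      by (cases "i = 0"; auto simp: simps)
    ultimately show ?thesis unfolding theta_def using 1 ord
      by (intro exI[of _ i] exI[of _ k] exI[of _ "[Suc i..<k]"] exI[of _ "j # rev [Suc k..<j]"]
          exI[of _ "rev [0..<i] @ rev [l..<n]"]) auto
  next
    case 2
    have "is_path E (k # [Suc k..<j] @ [j])" using 2 ord by (auto simp: simps)
    moreover have "is_path E (k # (l # rev [Suc j..<l]) @ [j])" using ord
      by (cases "Suc j < l"; auto simp: simps)
    moreover have "is_path E (k # rev [i..<k] @ [j])" using ord sy by (auto simp: simps)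
    ultimately show ?thesis unfolding theta_def using 2 ord
      by (intro exI[of _ k] exI[of _ j] exI[of _ "[Suc k..<j]"] exI[of _ "l # rev [Suc j..<l]"]
          exI[of _ "rev [i..<k]"]) auto
  next
    case 3
    have "is_path E (j # [Suc j..<l] @ [l])" using 3 ord by (auto simp: simps)
    moreover have "is_path E (j # (i # rev [0..<i] @ rev [Suc l..<n]) @ [l])" using ord sy
      by (cases "i = 0"; cases "Suc l < n"; auto simp: simps)
    moreover have "is_path E (j # rev [k..<j] @ [l])" using ord sy by (auto simp: simps)
    ultimately show ?thesis unfolding theta_def using 3 ord
      by (intro exI[of _ j] exI[of _ l] exI[of _ "[Suc j..<l]"] exI[of _
        "i # rev [0..<i] @ rev [Suc l..<n]"]
          exI[of _ "rev [k..<j]"]) auto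
  next
    case 4
    have "is_path E (l # ([Suc l..<n] @ [0..<i]) @ [i])" using 4 ord
      by (cases "i = 0"; cases "Suc l < n"; auto simp: simps)
    moreover have "is_path E (l # (k # rev [Suc i..<k]) @ [i])" using ord sy
      by (cases "Suc i < k"; auto simp: simps)
    moreover have "is_path E (l # rev [j..<l] @ [i])" using ord sy by (auto simp: simps)
    ultimately show ?thesis unfolding theta_def using 4 ord
      by (intro exI[of _ l] exI[of _ i] exI[of _ "[Suc l..<n] @ [0..<i]"] exI[of _
        "k # rev [Suc i..<k]"]
          exI[of _ "rev [j..<l]"]) auto
  qed
  then show False using th by blast
qed

text \<open>Beyond the length of \<open>vs\<close> the value \<open>vs ! i\<close> is unspecified.
  With the bounds built into the relation, all its edges have their ends in the range where the
  numbering is injective.\<close>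

definition relabel :: "('a \<Rightarrow> 'a \<Rightarrow> bool) \<Rightarrow> 'a list \<Rightarrow> nat \<Rightarrow> nat \<Rightarrow> bool" where
  "relabel E vs i j \<longleftrightarrow> i < length vs \<and> j < length vs \<and> E (vs ! i) (vs ! j)"

lemma relabel_bounded_path:
  assumes "is_path (relabel E vs) xs" "2 \<le> length xs"
  shows "set xs \<subseteq> {..<length vs}"
proof
  fix v assume "v \<in> set xs"
  then obtain k where k: "k < length xs" "v = xs ! k" by (metis in_set_conv_nth)
  have e: "relabel E vs (xs ! i) (xs ! Suc i)" if "Suc i < length xs" for i
    using assms that by (auto simp: is_path_def successively_conv_nth)
  show "v \<in> {..<length vs}"
  proof (cases k)
    case 0 then show ?thesis using e[of 0] k assms(2) by (auto simp: relabel_def)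
  next
    case (Suc l) then show ?thesis using e[of l] k by (auto simp: relabel_def)
  qed
qed

lemma relabel_path:
  assumes "distinct vs" "is_path (relabel E vs) xs" "2 \<le> length xs"
  shows "is_path E (map ((!) vs) xs)"
proof -
  have "inj_on ((!) vs) (set xs)"
    using relabel_bounded_path[OF assms(2,3)] by (intro inj_on_nth[OF assms(1)]) auto
  then show ?thesis using assms(2) unfolding is_path_def distinct_map successively_map
    by (auto elim!: successively_mono simp: relabel_def)
qed

lemma theta_relabel:
  assumes d: "distinct vs" and "theta (relabel E vs)"
  shows "theta E"
proof -
  let ?f = "(!) vs" and ?E = "relabel E vs"
  obtain x y xs ys zs where *: "xs \<noteq> []" "ys \<noteq> []" "zs \<noteq> []"
     "is_path ?E (x # xs @ [y])" "is_path ?E (x # ys @ [y])" "is_path ?E (x # zs @ [y])"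
     "set xs \<inter> set ys = {}" "set xs \<inter> set zs = {}" "set ys \<inter> set zs = {}"
    using assms(2) unfolding theta_def by blast
  have path: "is_path E (?f x # map ?f ws @ [?f y])" "set ws \<subseteq> {..<length vs}"
    if "is_path ?E (x # ws @ [y])" for ws
    using relabel_path[OF d that] relabel_bounded_path[OF that] by auto
  have inj: "inj_on ?f {..<length vs}" using d by (auto simp: inj_on_def nth_eq_iff_index_eq)
  have dis: "?f ` A \<inter> ?f ` B = {}" if "A \<inter> B = {}" "A \<subseteq> {..<length vs}" "B \<subseteq> {..<length vs}" for A B
    using inj_on_image_Int[OF inj that(2,3)] that(1) by simp
  show ?thesis
    unfolding theta_def using * path dis
    by (intro exI[of _ "?f x"] exI[of _ "?f y"] exI[of _ "map ?f xs"] exI[of _ "map ?f ys"] exI[of _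
      "map ?f zs"]) simp
qed

lemma relabel_induced_cycle:
  assumes d: "distinct vs" and D: "induced_cycle (relabel E vs) D"
  shows "set D \<subseteq> {..<length vs}" "induced_cycle E (map ((!) vs) D)"
proof -
  have p: "is_path (relabel E vs) D" "3 \<le> length D"
    using D by (auto simp: induced_cycle_def is_path_def successively_conv_nth)
  then show sub: "set D \<subseteq> {..<length vs}" using relabel_bounded_path[OF p(1)] by simp
  have "D ! i < length vs" if "i < length D" for i using sub that nth_mem by blast
  then have "relabel E vs (D ! i) (D ! j) \<longleftrightarrow> E (map ((!) vs) D ! i) (map ((!) vs) D ! j)"
    if "i < length D" "j < length D" for i j using that by (simp add: relabel_def)
  moreover have "distinct (map ((!) vs) D)" using relabel_path[OF d p(1)] p(2)
    by (simp add: is_path_def)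
  ultimately show "induced_cycle E (map ((!) vs) D)"
    using D unfolding induced_cycle_def by (simp only: length_map) (metis less_trans)
qed

lemma three_neighbours_relabel:
  assumes d: "distinct vs" and "three_neighbours (relabel E vs)"
  shows "three_neighbours E"
proof -
  let ?f = "(!) vs" and ?E = "relabel E vs"
  obtain D Ds where D: "induced_cycle ?E D" "length Ds = 3" "distinct (map set (D # Ds))"
    "\<And>C. C \<in> set Ds \<Longrightarrow> induced_cycle ?E C \<and> share_edge ?E D C"
    using assms(2) unfolding three_neighbours_def by blast
  have inj: "inj_on ?f {..<length vs}" using d by (auto simp: inj_on_def nth_eq_iff_index_eq)
  have sub: "set C \<subseteq> {..<length vs}" if "C \<in> set (D # Ds)" for C
    using relabel_induced_cycle(1)[OF d] D(1,4) that by auto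
  have "inj_on ((`) ?f) (set (map set (D # Ds)))"
    using inj_on_image_eq_iff[OF inj] sub by (auto simp: inj_on_def)
  then have "distinct (map ((`) ?f) (map set (D # Ds)))" using D(3) by (simp only: distinct_map)
  moreover have "map ((`) ?f) (map set (D # Ds)) = map set (map ?f D # map (map ?f) Ds)" by simp
  ultimately have "distinct (map set (map ?f D # map (map ?f) Ds))" by metis
  moreover have "induced_cycle E C \<and> share_edge E (map ?f D) C" if "C \<in> set (map (map ?f) Ds)" for C
  proof -
    have "C \<in> map ?f ` set Ds" using that by simp
    then obtain B where B: "B \<in> set Ds" "C = map ?f B" by blast
    have "share_edge E (map ?f D) C"
    proof -
      obtain u v where "u \<in> set D \<inter> set B" "v \<in> set D \<inter> set B" "?E u v"
        using D(4)[OF B(1)] unfolding share_edge_def by blast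
      then show ?thesis
        unfolding share_edge_def B(2)
          by (intro bexI[of _ "?f u"] bexI[of _ "?f v"]) (auto simp: relabel_def)
    qed
    then show ?thesis using relabel_induced_cycle(2)[OF d] D(4)[OF B(1)] B(2) by blast
  qed
  ultimately show ?thesis
    unfolding three_neighbours_def using relabel_induced_cycle(2)[OF d D(1)] D(2)
    by (intro exI[of _ "map ?f D"] exI[of _ "map (map ?f) Ds"]) simp
qed

section \<open>Outerplanar embeddings\<close>

lemma unbounded_connected_subset_outside:
  assumes "Topological_Spaces.connected F" "\<not> bounded F" "F \<inter> S = {}"
  shows "F \<subseteq> outside S"
proof
  fix x assume "x \<in> F"
  then have "F \<subseteq> connected_component_set (- S) x"
    using assms by (intro connected_component_maximal) auto
  then show "x \<in> outside S" using assms(2) bounded_subset unfolding outside by blast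
qed

lemma two_arcs_Jordan:
  fixes g h :: "real \<Rightarrow> complex"
  assumes "arc g" "arc h" "pathstart g = a" "pathfinish g = b" "pathstart h = a" "pathfinish h = b"
    "path_image g \<inter> path_image h = {a, b}"
  defines "S \<equiv> path_image g \<union> path_image h"
  shows "inside S \<noteq> {}" "open (inside S)" "Topological_Spaces.connected (inside S)"
    "open (outside S)" "Topological_Spaces.connected (outside S)"
    "frontier (inside S) = S"
proof -
  have "simple_path (g +++ reversepath h)"
    using assms by (intro simple_path_join_loop) (auto simp: arc_reversepath)
  moreover have "pathfinish (g +++ reversepath h) = pathstart (g +++ reversepath h)"
    using assms by simp
  moreover have "path_image (g +++ reversepath h) = S"
    using assms by (simp add: path_image_join)
  ultimately show "inside S \<noteq> {}" "open (inside S)" "Topological_Spaces.connected (inside S)"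
    "open (outside S)"
    "Topological_Spaces.connected (outside S)" "frontier (inside S) = S"
    using Jordan_inside_outside[of "g +++ reversepath h"] by auto
qed

text \<open>Without its ends, \<open>k\<close> is connected and misses the loop, so it lies on one
  side. This is the outer side: \<open>F\<close> is outside, the inside is open, and hence
  \<open>q\<close>, a limit point of \<open>F\<close>, is not inside.\<close>

lemma arc_not_inside_loop:
  fixes g h k :: "real \<Rightarrow> complex"
  assumes g: "arc g" "pathstart g = a" "pathfinish g = b"
    and h: "arc h" "pathstart h = a" "pathfinish h = b"
    and k: "arc k" "pathstart k = a" "pathfinish k = b"
    and int: "path_image g \<inter> path_image h = {a, b}" "path_image g \<inter> path_image k = {a, b}"
      "path_image h \<inter> path_image k = {a, b}"
    and F: "Topological_Spaces.connected F" "\<not> bounded F" "F \<inter> path_image g = {}"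
      "F \<inter> path_image h = {}"
    and q: "q \<in> closure F" "q \<in> path_image k - {a, b}"
  shows "path_image k \<inter> inside (path_image g \<union> path_image h) = {}"
proof (rule ccontr)
  define S where "S = path_image g \<union> path_image h"
  assume "path_image k \<inter> inside (path_image g \<union> path_image h) \<noteq> {}"
  then obtain z where z: "z \<in> path_image k" "z \<in> inside S" by (auto simp: S_def)
  note J = two_arcs_Jordan[OF g(1) h(1) g(2,3) h(2,3) int(1), folded S_def]
  have "a \<in> S" "b \<in> S" using int by (auto simp: S_def)
  then have zT: "z \<in> path_image k - {a, b}" using z inside_no_overlap[of S] by blast
  have con: "Topological_Spaces.connected (path_image k - {a, b})"
    using connected_simple_path_endless[of k] k by (simp add: arc_imp_simple_path)
  have "F \<subseteq> outside S" using F by (intro unbounded_connected_subset_outside) (auto simp: S_def)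
  then have "F \<inter> inside S = {}" using inside_Int_outside[of S] by blast
  then have "q \<notin> inside S" using q(1) open_Int_closure_eq_empty[OF J(2), of F] by blast
  moreover have "q \<notin> S" using q int by (auto simp: S_def)
  ultimately have "q \<in> outside S" unfolding outside_inside by blast
  then have "S \<inter> (path_image k - {a, b}) \<noteq> {}"
    using inside_outside_intersect_connected[OF con, of S] z zT q(2) by blast
  then show False using int by (auto simp: S_def)
qed

text \<open>A connected set that meets another set but not its frontier is contained in it; this is
  applied in both directions.\<close>

lemma connected_eq_frontier:
  assumes "Topological_Spaces.connected U" "Topological_Spaces.connected W" "U \<inter> W \<noteq> {}"
    "U \<inter> frontier W = {}" "W \<inter> frontier U = {}"
  shows "U = W"
proof -
  have "U - W = {}" "W - U = {}"
    using connected_Int_frontier[of U W] connected_Int_frontier[of W U] assms by (metis Int_commute)+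
  then show ?thesis by blast
qed

text \<open>
  The points \<open>q i\<close> keep each arc out of the loop formed by the other two. By Janiszewski's theorem a point
  inside one of the three loops can then be joined to \<open>F\<close> off the whole theta curve, unless two of the
  insides coincide. They do not, since their frontiers differ.
\<close>

lemma theta_curve_outer:
  fixes g :: "nat \<Rightarrow> real \<Rightarrow> complex"
  assumes g: "\<And>i. i < 3 \<Longrightarrow> arc (g i)" "\<And>i. i < 3 \<Longrightarrow> pathstart (g i) = a"
    "\<And>i. i < 3 \<Longrightarrow> pathfinish (g i) = b"
    and int: "\<And>i j. i < 3 \<Longrightarrow> j < 3 \<Longrightarrow> i \<noteq> j \<Longrightarrow> path_image (g i) \<inter> path_image (g j) = {a, b}"
    and F: "Topological_Spaces.connected F" "\<not> bounded F" "\<And>i. i < 3 \<Longrightarrow> F \<inter> path_image (g i) = {}"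
    and q: "\<And>i. i < 3 \<Longrightarrow> q i \<in> closure F" "\<And>i. i < 3 \<Longrightarrow> q i \<in> path_image (g i) - {a, b}"
  shows False
proof -
  define S where "S i j = path_image (g i) \<union> path_image (g j)" for i j
  have J: "inside (S i j) \<noteq> {}" "open (inside (S i j))"
    "Topological_Spaces.connected (inside (S i j))" "Topological_Spaces.connected (outside (S i j))"
    "frontier (inside (S i j)) = S i j" if "i < 3" "j < 3" "i \<noteq> j" for i j
    unfolding S_def using two_arcs_Jordan[OF g(1) g(1) g(2) g(3) g(2) g(3) int] that by blast+
  have ni: "path_image (g k) \<inter> inside (S i j) = {}"
    if "i < 3" "j < 3" "k < 3" "i \<noteq> j" "k \<noteq> i" "k \<noteq> j" for i j k
    unfolding S_def
    by (rule arc_not_inside_loop[where a = a and b = b and q = "q k" and F = F])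
       (use that g int F q in \<open>simp_all\<close>)
  have noteq: False if *: "i < 3" "j < 3" "k < 3" "i \<noteq> j" "k \<noteq> i" "k \<noteq> j"
    "inside (S i j) \<inter> inside (S i k) \<noteq> {}" for i j k
  proof -
    have "path_image (g k) \<inter> inside (S i j) = {}" "path_image (g j) \<inter> inside (S i k) = {}"
      using ni[of i j k] ni[of i k j] * by simp_all
    moreover have "inside (S i j) \<inter> S i j = {}" "inside (S i k) \<inter> S i k = {}"
      by (rule inside_no_overlap)+
    moreover have "S i k \<subseteq> S i j \<union> path_image (g k)" "S i j \<subseteq> S i k \<union> path_image (g j)"
      by (auto simp: S_def)
    ultimately have dis: "inside (S i j) \<inter> S i k = {}" "inside (S i k) \<inter> S i j = {}" by blast+
    have fr: "frontier (inside (S i j)) = S i j" "frontier (inside (S i k)) = S i k"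
      using J(5)[of i j] J(5)[of i k] * by simp_all
    have "inside (S i j) = inside (S i k)"
    proof (rule connected_eq_frontier)
      show "Topological_Spaces.connected (inside (S i j))"
        "Topological_Spaces.connected (inside (S i k))"
        using J(3)[of i j] J(3)[of i k] * by simp_all
      show "inside (S i j) \<inter> frontier (inside (S i k)) = {}"
        "inside (S i k) \<inter> frontier (inside (S i j)) = {}"
        unfolding fr by (rule dis)+
    qed (rule *(7))
    then have "frontier (inside (S i j)) = frontier (inside (S i k))" by (rule arg_cong)
    then have "S i j = S i k" unfolding fr .
    moreover have "path_image (g i) \<inter> path_image (g j) = {a, b}"
      "path_image (g j) \<inter> path_image (g k) = {a, b}"
      using * by (intro int; simp)+
    then have "q j \<notin> S i k" using q(2)[OF *(2)] unfolding S_def by blast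
    moreover have "q j \<in> S i j" using q(2)[OF *(2)] unfolding S_def by blast
    ultimately show False by simp
  qed
  obtain z where z: "z \<in> inside (S 0 1)" using J(1)[of 0 1] by auto
  obtain w where w: "w \<in> F" using F(2) by fastforce
  have wo: "w \<in> outside (S i j)" if "i < 3" "j < 3" for i j
    using unbounded_connected_subset_outside[OF F(1,2), of "S i j"] F(3) that w unfolding S_def
      by blast
  have "z \<notin> path_image (g 2)" using z ni[of 0 1 2] by auto
  moreover have "z \<notin> S 0 1" using z inside_no_overlap[of "S 0 1"] by blast
  ultimately have "z \<notin> S 0 2" "z \<notin> S 1 2" unfolding S_def by blast+
  moreover have "z \<notin> inside (S 0 2)" using noteq[of 0 1 2] z by auto
  moreover have "z \<notin> inside (S 1 2)" using noteq[of 1 0 2] z by (auto simp: S_def Un_commute)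
  ultimately have zo: "z \<in> outside (S 0 2)" "z \<in> outside (S 1 2)" by (auto simp: outside_inside)
  have cc: "connected_component (- S i j) z w" if "z \<in> outside (S i j)" "i < 3" "j < 3" "i \<noteq> j"
    for i j
    unfolding connected_component_def using J(4)[of i j] wo that outside_no_overlap[of "S i j"]
      by blast
  have cpt: "compact (S i j)" if "i < 3" "j < 3" for i j
    unfolding S_def using that g(1) by (intro compact_Un compact_path_image arc_imp_path) auto
  \<comment> \<open>Janiszewski's theorem requires the two loops to have a connected intersection,
    which is their common arc. It connects \<open>z\<close> to \<open>w\<close> off all three arcs,
    hence off \<open>S 0 1\<close>, although \<open>z\<close> is inside that loop and
    \<open>w\<close> outside.\<close>
  have "S 0 2 \<inter> S 1 2 = path_image (g 2)" using int[of 0 1] int[of 0 2] unfolding S_def by auto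
  then have "Topological_Spaces.connected (S 0 2 \<inter> S 1 2)" using g(1)[of 2]
    by (simp add: connected_path_image arc_imp_path)
  then have "connected_component (- (S 0 2 \<union> S 1 2)) z w"
    using cc[of 0 2] cc[of 1 2] zo cpt by (intro Janiszewski) (auto intro: compact_imp_closed)
  then have "connected_component (- S 0 1) z w"
    by (rule connected_component_of_subset) (auto simp: S_def)
  then have "z \<in> outside (S 0 1)" using wo[of 0 1] outside_same_component connected_component_sym
    by fastforce
  then show False using z inside_Int_outside by blast
qed

section \<open>Drawn paths and the absence of thetas\<close>

fun trace :: "('a \<times> 'a \<Rightarrow> real \<Rightarrow> complex) \<Rightarrow> 'a list \<Rightarrow> complex set" where
  "trace c (x # y # xs) = path_image (c (x, y)) \<union> trace c (y # xs)"
| "trace c _ = {}"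

lemma trace_iff:
  "z \<in> trace c xs \<longleftrightarrow> (\<exists>i. Suc i < length xs \<and> z \<in> path_image (c (xs ! i, xs ! Suc i)))"
proof (induction c xs rule: trace.induct)
  case (1 c x y xs)
  show ?case
  proof
    assume "z \<in> trace c (x # y # xs)"
    then consider "z \<in> path_image (c (x, y))" | i where "Suc i < length (y # xs)"
      "z \<in> path_image (c ((y # xs) ! i, (y # xs) ! Suc i))"
      using 1 by auto
    then show "\<exists>i. Suc i < length (x # y # xs) \<and> z \<in> path_image (c ((x # y # xs) ! i, (x # y # xs) ! Suc i))"
    proof cases
      case 1 then show ?thesis by (intro exI[of _ 0]) auto
    next
      case (2 i) then show ?thesis by (intro exI[of _ "Suc i"]) auto
    qed
  next
    assume "\<exists>i. Suc i < length (x # y # xs) \<and> z \<in> path_image (c ((x # y # xs) ! i, (x # y # xs) ! Suc i))"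
    then obtain i where i: "Suc i < length (x # y # xs)"
      "z \<in> path_image (c ((x # y # xs) ! i, (x # y # xs) ! Suc i))" by blast
    then show "z \<in> trace c (x # y # xs)" using 1 by (cases i) auto
  qed
qed auto

locale outerplane_graph =
  fixes G :: "'a pair_pre_digraph" and p :: "'a \<Rightarrow> complex" and c :: "'a \<times> 'a \<Rightarrow> real \<Rightarrow> complex"
  assumes graph: "pair_graph G" and embedding: "outerplanar_embedding G p c"
begin

definition E :: "'a \<Rightarrow> 'a \<Rightarrow> bool" where "E u v \<longleftrightarrow> (u, v) \<in> parcs G"

lemma symp_E: "symp E"
proof -
  interpret pair_graph G by (rule graph)
  show ?thesis using pair_sym_arcs by (auto simp: E_def symp_def symmetric_def sym_def)
qed

lemma E_vertices: assumes "E u v" shows "u \<in> pverts G" "v \<in> pverts G" "u \<noteq> v"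
proof -
  interpret pair_graph G by (rule graph)
  show "u \<in> pverts G" "v \<in> pverts G" "u \<noteq> v"
    using assms in_arcsD1[of u v] in_arcsD2[of u v] no_loops'[of u] unfolding E_def by auto
qed

lemma plane: "plane_embedding G p c"
  using embedding unfolding outerplanar_embedding_def by blast

lemma p_inj: "u \<in> pverts G \<Longrightarrow> v \<in> pverts G \<Longrightarrow> p u = p v \<longleftrightarrow> u = v"
  using plane unfolding plane_embedding_def inj_on_def by blast

lemma edge_curve:
  assumes "E u v"
  shows "arc (c (u, v))" "pathstart (c (u, v)) = p u" "pathfinish (c (u, v)) = p v"
    "path_image (c (v, u)) = path_image (c (u, v))"
    "\<And>w. w \<in> pverts G \<Longrightarrow> p w \<in> path_image (c (u, v)) \<Longrightarrow> w \<in> {u, v}"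
proof -
  have *: "arc (c (u, v)) \<and> pathstart (c (u, v)) = p u \<and> pathfinish (c (u, v)) = p v \<and>
        c (v, u) = reversepath (c (u, v)) \<and>
        (\<forall>w \<in> pverts G. p w \<in> path_image (c (u, v)) \<longrightarrow> w \<in> {u, v})"
    using plane assms unfolding plane_embedding_def E_def by fast
  then show "arc (c (u, v))" "pathstart (c (u, v)) = p u" "pathfinish (c (u, v)) = p v"
    "path_image (c (v, u)) = path_image (c (u, v))"
    "\<And>w. w \<in> pverts G \<Longrightarrow> p w \<in> path_image (c (u, v)) \<Longrightarrow> w \<in> {u, v}"
    by (auto simp: path_image_reversepath)
qed

lemma edge_curve_Int:
  assumes "E u v" "E x y" "{u, v} \<noteq> {x, y}"
  shows "path_image (c (u, v)) \<inter> path_image (c (x, y)) \<subseteq> p ` ({u, v} \<inter> {x, y})"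
  using plane assms unfolding plane_embedding_def E_def by fast

lemma edge_curve_ends: "E u v \<Longrightarrow> p u \<in> path_image (c (u, v))" "E u v \<Longrightarrow> p v \<in> path_image (c (u, v))"
  using edge_curve pathstart_in_path_image pathfinish_in_path_image by metis+

lemma is_path_edge: "is_path E xs \<Longrightarrow> Suc i < length xs \<Longrightarrow> E (xs ! i) (xs ! Suc i)"
  by (auto simp: is_path_def successively_conv_nth)

lemma is_path_vertices:
  assumes "is_path E xs" "2 \<le> length xs"
  shows "set xs \<subseteq> pverts G"
proof
  fix v assume "v \<in> set xs"
  then obtain k where k: "k < length xs" "v = xs ! k" by (metis in_set_conv_nth)
  show "v \<in> pverts G"
  proof (cases k)
    case 0 then show ?thesis using E_vertices(1)[OF is_path_edge[OF assms(1), of 0]] k assms(2)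
      by auto
  next
    case (Suc l) then show ?thesis using E_vertices(2)[OF is_path_edge[OF assms(1), of l]] k by auto
  qed
qed

lemma vertex_in_trace:
  assumes "is_path E xs" "2 \<le> length xs" "w \<in> pverts G"
  shows "p w \<in> trace c xs \<longleftrightarrow> w \<in> set xs"
proof
  assume "p w \<in> trace c xs"
  then obtain i where i: "Suc i < length xs" "p w \<in> path_image (c (xs ! i, xs ! Suc i))"
    by (auto simp: trace_iff)
  then show "w \<in> set xs" using edge_curve(5)[OF is_path_edge[OF assms(1) i(1)] assms(3)] by auto
next
  assume "w \<in> set xs"
  then obtain i where i: "i < length xs" "w = xs ! i" by (metis in_set_conv_nth)
  show "p w \<in> trace c xs"
  proof (cases "Suc i < length xs")
    case True
    then show ?thesis using edge_curve_ends(1)[OF is_path_edge[OF assms(1) True]] i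
      unfolding trace_iff by auto
  next
    case False
    then obtain k where k: "i = Suc k" using i assms(2) by (cases i) auto
    then show ?thesis using edge_curve_ends(2)[OF is_path_edge[OF assms(1), of k]] i
      unfolding trace_iff by auto
  qed
qed

text \<open>Curves of different edges share at most the images of common ends, so it suffices that
  the two paths have no edge in common.\<close>

lemma trace_Int:
  assumes xs: "is_path E xs" and ys: "is_path E ys"
    and ne: "\<And>i j. Suc i < length xs \<Longrightarrow> Suc j < length ys \<Longrightarrow> {xs ! i, xs ! Suc i} \<noteq> {ys ! j, ys ! Suc j}"
  shows "trace c xs \<inter> trace c ys \<subseteq> p ` (set xs \<inter> set ys)"
proof
  fix z assume "z \<in> trace c xs \<inter> trace c ys"
  then obtain i j where ij: "Suc i < length xs" "Suc j < length ys"
    "z \<in> path_image (c (xs ! i, xs ! Suc i))" "z \<in> path_image (c (ys ! j, ys ! Suc j))"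
    by (auto simp: trace_iff)
  then have "z \<in> p ` ({xs ! i, xs ! Suc i} \<inter> {ys ! j, ys ! Suc j})"
    using edge_curve_Int[OF is_path_edge[OF xs ij(1)] is_path_edge[OF ys ij(2)] ne[OF ij(1,2)]]
      by blast
  moreover have "{xs ! i, xs ! Suc i} \<subseteq> set xs" "{ys ! j, ys ! Suc j} \<subseteq> set ys" using ij by auto
  ultimately show "z \<in> p ` (set xs \<inter> set ys)" by blast
qed

lemma arc_of_path:
  assumes "is_path E xs" "2 \<le> length xs"
  shows "\<exists>g. arc g \<and> pathstart g = p (hd xs) \<and> pathfinish g = p (last xs) \<and> path_image g = trace c xs"
  using assms
proof (induction xs rule: induct_list012)
  case (3 x y xs)
  have xy: "E x y" using 3 by (simp add: is_path_def)
  show ?case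
  proof (cases xs)
    case Nil
    then show ?thesis using edge_curve[OF xy] by auto
  next
    case (Cons z zs)
    have pt: "is_path E (y # xs)" using 3 by (simp add: is_path_def)
    then obtain g where g: "arc g" "pathstart g = p y" "pathfinish g = p (last xs)"
      "path_image g = trace c (y # xs)"
      using 3 Cons by auto
    have x: "x \<notin> set (y # xs)" using 3 by (auto simp: is_path_def)
    have pxy: "is_path E [x, y]" using xy x by (auto simp: is_path_def)
    have "trace c [x, y] \<inter> trace c (y # xs) \<subseteq> p ` (set [x, y] \<inter> set (y # xs))"
    proof (rule trace_Int[OF pxy pt])
      fix i j assume "Suc i < length [x, y]" "Suc j < length (y # xs)"
      moreover from this have "(y # xs) ! j \<in> set (y # xs)" "(y # xs) ! Suc j \<in> set (y # xs)"
        by (metis Suc_lessD nth_mem)+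
      moreover from calculation have "x \<in> {[x, y] ! i, [x, y] ! Suc i}" by auto
      ultimately show "{[x, y] ! i, [x, y] ! Suc i} \<noteq> {(y # xs) ! j, (y # xs) ! Suc j}"
        using x by (metis insertE singletonD)
    qed
    then have "path_image (c (x, y)) \<inter> path_image g \<subseteq> {pathstart g}" using x g by auto
    then have "arc (c (x, y) +++ g)" using g edge_curve[OF xy] by (intro arc_join) auto
    then show ?thesis using g edge_curve[OF xy] Cons
      by (intro exI[of _ "c (x, y) +++ g"]) (auto simp: path_image_join)
  qed
qed auto

text \<open>Keeps the edges of a path apart from an edge joining its two ends: the closing edge of a
  cycle, or an edge that two paths of a theta might share.\<close>

lemma ends_not_consecutive:
  assumes "distinct xs" "3 \<le> length xs" "Suc i < length xs"
  shows "{xs ! i, xs ! Suc i} \<noteq> {hd xs, last xs}"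
proof
  assume eq: "{xs ! i, xs ! Suc i} = {hd xs, last xs}"
  have "xs \<noteq> []" using assms by auto
  then have hl: "hd xs = xs ! 0" "last xs = xs ! (length xs - 1)"
    by (auto simp: hd_conv_nth last_conv_nth)
  have inj: "xs ! k = xs ! l \<longleftrightarrow> k = l" if "k < length xs" "l < length xs" for k l
    using assms that by (simp add: nth_eq_iff_index_eq)
  have "0 < length xs" "length xs - 1 < length xs" "i < length xs" using assms by auto
  then have "i = 0 \<and> Suc i = length xs - 1 \<or> i = length xs - 1 \<and> Suc i = 0"
    using eq inj assms(3) unfolding hl doubleton_eq_iff by blast
  then show False using assms by auto
qed

lemma trace_in_drawing: "is_path E xs \<Longrightarrow> trace c xs \<subseteq> drawing G p c"
  using is_path_edge by (fastforce simp: trace_iff drawing_def E_def)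

lemma outer_face:
  obtains F where "Topological_Spaces.connected F" "\<not> bounded F" "F \<inter> drawing G p c = {}"
    "\<And>v. v \<in> pverts G \<Longrightarrow> p v \<in> closure F"
proof -
  obtain F where F: "F \<in> faces G p c" "\<not> bounded F" "\<forall>v \<in> pverts G. p v \<in> frontier F"
    using embedding unfolding outerplanar_embedding_def by blast
  show ?thesis
  proof
    show "Topological_Spaces.connected F" using F(1) unfolding faces_def
      by (rule in_components_connected)
    show "F \<inter> drawing G p c = {}" using in_components_subset[OF F(1)[unfolded faces_def]] by auto
    show "p v \<in> closure F" if "v \<in> pverts G" for v using F(3) that by (auto simp: frontier_def)
  qed (rule F(2))
qed

text \<open>The outer face touches every vertex, so any inner vertex of a path of the theta provides
  the point \<open>q i\<close> asked for by \<open>theta_curve_outer\<close>.\<close>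

lemma no_theta: "\<not> theta E"
proof
  assume "theta E"
  then obtain x y xs ys zs where th: "xs \<noteq> []" "ys \<noteq> []" "zs \<noteq> []"
     "is_path E (x # xs @ [y])" "is_path E (x # ys @ [y])" "is_path E (x # zs @ [y])"
     "set xs \<inter> set ys = {}" "set xs \<inter> set zs = {}" "set ys \<inter> set zs = {}"
    unfolding theta_def by blast
  define W where "W i = [xs, ys, zs] ! i" for i :: nat
  define Q where "Q i = x # W i @ [y]" for i
  have W: "W i \<noteq> []" and Q: "is_path E (Q i)" if "i < 3" for i
    using that th by (auto simp: W_def Q_def less_Suc_eq numeral_3_eq_3)
  have disj: "set (W i) \<inter> set (W j) = {}" if "i < 3" "j < 3" "i \<noteq> j" for i j
    using that th by (auto simp: W_def less_Suc_eq numeral_3_eq_3)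
  have hl: "hd (Q i) = x" "last (Q i) = y" "set (Q i) = {x, y} \<union> set (W i)" for i
    by (auto simp: Q_def)
  have len: "3 \<le> length (Q i)" if "i < 3" for i using W[OF that] by (cases "W i") (auto simp: Q_def)
  have vert: "set (Q i) \<subseteq> pverts G" if "i < 3" for i
    using is_path_vertices[OF Q] len that by force
  have xy: "x \<in> pverts G" "y \<in> pverts G" using vert[of 0] hl by auto
  have "\<exists>g. arc g \<and> pathstart g = p x \<and> pathfinish g = p y \<and> path_image g = trace c (Q i)"
    if "i < 3" for i
    using arc_of_path[OF Q[OF that]] len[OF that] unfolding hl by simp
  then obtain g where g: "arc (g i)" "pathstart (g i) = p x" "pathfinish (g i) = p y"
    "path_image (g i) = trace c (Q i)" if "i < 3" for i
    by metis
  obtain F where F: "Topological_Spaces.connected F" "\<not> bounded F" "F \<inter> drawing G p c = {}"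
    "\<And>v. v \<in> pverts G \<Longrightarrow> p v \<in> closure F"
    using outer_face by blast
  show False
  proof (rule theta_curve_outer[of g "p x" "p y" F "\<lambda>i. p (hd (W i))"])
    show "arc (g i)" "pathstart (g i) = p x" "pathfinish (g i) = p y" if "i < 3" for i
      by (fact g(1-3)[OF that])+
    show "F \<inter> path_image (g i) = {}" if "i < 3" for i
      using g(4)[OF that] trace_in_drawing[OF Q[OF that]] F(3) by auto
    fix i :: nat assume i: "i < 3"
    have h: "hd (W i) \<in> set (W i)" using W[OF i] by simp
    then have v: "hd (W i) \<in> pverts G" using vert[OF i] hl by auto
    then show "p (hd (W i)) \<in> closure F" by (rule F(4))
    have "hd (W i) \<noteq> x" "hd (W i) \<noteq> y" using Q[OF i] h by (auto simp: is_path_def Q_def)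
    moreover have "p (hd (W i)) \<in> trace c (Q i)"
      using vertex_in_trace[OF Q[OF i] _ v] len[OF i] h hl by auto
    ultimately show "p (hd (W i)) \<in> path_image (g i) - {p x, p y}" using g(4)[OF i] p_inj[OF v] xy
      by auto
  next
    fix i j :: nat assume ij: "i < 3" "j < 3" "i \<noteq> j"
    have QQ: "set (Q i) \<inter> set (Q j) = {x, y}" unfolding hl using disj[OF ij] by auto
    have "trace c (Q i) \<inter> trace c (Q j) \<subseteq> p ` (set (Q i) \<inter> set (Q j))"
    proof (rule trace_Int[OF Q[OF ij(1)] Q[OF ij(2)]], rule notI)
      fix k l assume kl: "Suc k < length (Q i)" "Suc l < length (Q j)"
        and eq: "{Q i ! k, Q i ! Suc k} = {Q j ! l, Q j ! Suc l}"
      have "{Q i ! k, Q i ! Suc k} \<subseteq> set (Q i)" "{Q j ! l, Q j ! Suc l} \<subseteq> set (Q j)" using kl by auto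
      then have "{Q i ! k, Q i ! Suc k} \<subseteq> {x, y}" using eq QQ by blast
      moreover have "Q i ! k \<noteq> Q i ! Suc k"
        using E_vertices(3)[OF is_path_edge[OF Q[OF ij(1)] kl(1)]] .
      ultimately have "{Q i ! k, Q i ! Suc k} = {x, y}" by blast
      then show False using ends_not_consecutive[of "Q i" k] Q[OF ij(1)] len[OF ij(1)] kl(1) hl
        by (auto simp: is_path_def)
    qed
    then have "trace c (Q i) \<inter> trace c (Q j) \<subseteq> {p x, p y}" unfolding QQ by simp
    moreover have "{p x, p y} \<subseteq> path_image (g i) \<inter> path_image (g j)"
      using pathstart_in_path_image[of "g i"] pathfinish_in_path_image[of "g i"]
        pathstart_in_path_image[of "g j"] pathfinish_in_path_image[of "g j"]
      unfolding g(2,3)[OF ij(1)] g(2,3)[OF ij(2)] by blast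
    ultimately show "path_image (g i) \<inter> path_image (g j) = {p x, p y}"
      unfolding g(4)[OF ij(1)] g(4)[OF ij(2)] by (rule equalityI)
  qed (rule F)+
qed

section \<open>Induced cycles as bounded faces\<close>

definition loop :: "'a list \<Rightarrow> complex set" where
  "loop D = trace c D \<union> path_image (c (last D, hd D))"

lemma induced_cycle_path:
  assumes "induced_cycle E D"
  shows "is_path E D" "E (last D) (hd D)" "3 \<le> length D" "D \<noteq> []"
proof -
  show l: "3 \<le> length D" and ne: "D \<noteq> []" using assms by (auto simp: induced_cycle_def)
  show "is_path E D" using assms by (auto simp: induced_cycle_def is_path_def successively_conv_nth)
  have "E (D ! 0) (D ! (length D - 1))" using assms l unfolding induced_cycle_def by auto
  then show "E (last D) (hd D)" using ne symp_E by (auto simp: hd_conv_nth last_conv_nth dest: sympD)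
qed

lemma simple_loop:
  assumes "induced_cycle E D"
  obtains g where "simple_path g" "pathfinish g = pathstart g" "path_image g = loop D"
proof -
  note D = induced_cycle_path[OF assms]
  obtain g where g: "arc g" "pathstart g = p (hd D)" "pathfinish g = p (last D)"
    "path_image g = trace c D"
    using arc_of_path[OF D(1)] D(3) by auto
  let ?h = "c (last D, hd D)"
  have h: "arc ?h" "pathstart ?h = p (last D)" "pathfinish ?h = p (hd D)" using edge_curve[OF D(2)]
    by auto
  have pl: "is_path E [last D, hd D]" using D(2) E_vertices(3)[OF D(2)] by (simp add: is_path_def)
  have "trace c D \<inter> trace c [last D, hd D] \<subseteq> p ` (set D \<inter> set [last D, hd D])"
  proof (rule trace_Int[OF D(1) pl])
    fix i j assume i: "Suc i < length D" and j: "Suc j < length [last D, hd D]"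
    have "{D ! i, D ! Suc i} \<noteq> {hd D, last D}"
      using D(1) i by (intro ends_not_consecutive D(3)) (auto simp: is_path_def)
    then show "{D ! i, D ! Suc i} \<noteq> {[last D, hd D] ! j, [last D, hd D] ! Suc j}"
      using j by (simp add: insert_commute)
  qed
  then have "path_image g \<inter> path_image ?h \<subseteq> {pathstart g, pathstart ?h}" using g h by auto
  then have "simple_path (g +++ ?h)" using g h by (intro simple_path_join_loop) auto
  then show ?thesis using that[of "g +++ ?h"] g h by (auto simp: path_image_join loop_def)
qed

lemma loop_vertex:
  assumes "induced_cycle E D" "w \<in> pverts G"
  shows "p w \<in> loop D \<longleftrightarrow> w \<in> set D"
proof -
  note D = induced_cycle_path[OF assms(1)]
  have "p w \<in> trace c D \<longleftrightarrow> w \<in> set D" using vertex_in_trace[OF D(1) _ assms(2)] D(3) by simp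
  moreover have "w \<in> set D" if "p w \<in> path_image (c (last D, hd D))"
    using edge_curve(5)[OF D(2) assms(2) that] D(4) by auto
  ultimately show ?thesis unfolding loop_def by blast
qed

lemma loop_edge:
  assumes "induced_cycle E D" "u \<in> set D" "v \<in> set D" "E u v"
  shows "path_image (c (u, v)) \<subseteq> loop D"
proof -
  note D = induced_cycle_path[OF assms(1)]
  have *: "path_image (c (D ! i, D ! j)) \<subseteq> loop D" if ij: "i < j" "j < length D" "E (D ! i) (D ! j)"
    for i j
  proof -
    have "j = Suc i \<or> i = 0 \<and> j = length D - 1" using assms(1) ij unfolding induced_cycle_def by blast
    then show ?thesis
    proof
      assume "j = Suc i"
      then show ?thesis using ij by (auto simp: loop_def trace_iff)
    next
      assume "i = 0 \<and> j = length D - 1"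
      then show ?thesis using edge_curve(4)[OF ij(3)] D(4)
        by (auto simp: loop_def hd_conv_nth last_conv_nth)
    qed
  qed
  obtain i j where ij: "i < length D" "j < length D" "u = D ! i" "v = D ! j"
    using assms by (metis in_set_conv_nth)
  have "i \<noteq> j" using E_vertices(3)[OF assms(4)] ij by auto
  then consider "i < j" | "j < i" by linarith
  then show ?thesis
  proof cases
    case 1 then show ?thesis using *[of i j] ij assms(4) by auto
  next
    case 2
    have "E v u" using assms(4) symp_E by (auto dest: sympD)
    then show ?thesis using *[of j i] 2 ij edge_curve(4)[OF assms(4)] by auto
  qed
qed

lemma loop_in_drawing: "induced_cycle E D \<Longrightarrow> loop D \<subseteq> drawing G p c"
  using induced_cycle_path(1,2)[of D] trace_in_drawing by (auto simp: loop_def drawing_def E_def)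

text \<open>The outer face lies outside the loop and has every vertex in its closure, whereas the
  inside is open.\<close>

lemma vertex_not_inside:
  assumes "induced_cycle E D" "v \<in> pverts G"
  shows "p v \<notin> inside (loop D)"
proof -
  obtain g where g: "simple_path g" "pathfinish g = pathstart g" "path_image g = loop D"
    using simple_loop assms by blast
  have op: "open (inside (loop D))" using Jordan_inside_outside[OF g(1,2)] g(3) by simp
  obtain F where F: "Topological_Spaces.connected F" "\<not> bounded F" "F \<inter> drawing G p c = {}"
    "\<And>v. v \<in> pverts G \<Longrightarrow> p v \<in> closure F"
    using outer_face by blast
  have "F \<subseteq> outside (loop D)"
    using F(3) loop_in_drawing[OF assms(1)] by (intro unbounded_connected_subset_outside F) auto
  then have "inside (loop D) \<inter> F = {}" using inside_Int_outside[of "loop D"] by blast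
  then have "inside (loop D) \<inter> closure F = {}" using open_Int_closure_eq_empty[OF op] by blast
  then show ?thesis using F(4)[OF assms(2)] by blast
qed

text \<open>An edge with both ends on \<open>D\<close> is an edge of \<open>D\<close>, as
  \<open>D\<close> is induced, so its curve is part of the loop. The interior of any other edge
  misses the loop; if it entered the inside it would stay there, and its ends, which are not inside,
  would be on the loop and hence on \<open>D\<close>.\<close>

lemma edge_not_inside:
  assumes "induced_cycle E D" "E u v"
  shows "path_image (c (u, v)) \<inter> inside (loop D) = {}"
proof (rule ccontr)
  assume "path_image (c (u, v)) \<inter> inside (loop D) \<noteq> {}"
  then obtain z where z: "z \<in> path_image (c (u, v))" "z \<in> inside (loop D)" by blast
  note D = induced_cycle_path[OF assms(1)]
  note e = edge_curve[OF assms(2)] and uv = E_vertices[OF assms(2)]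
  define T where "T = path_image (c (u, v)) - {p u, p v}"
  have zT: "z \<in> T" using z vertex_not_inside[OF assms(1)] uv by (auto simp: T_def)
  obtain g where g: "simple_path g" "pathfinish g = pathstart g" "path_image g = loop D"
    using simple_loop assms by blast
  have fr: "frontier (inside (loop D)) = loop D" using Jordan_inside_outside[OF g(1,2)] g(3) by simp
  have nD: "\<not> (u \<in> set D \<and> v \<in> set D)"
    using loop_edge[OF assms(1) _ _ assms(2)] z inside_no_overlap[of "loop D"] by blast
  have Tl: "T \<inter> loop D = {}"
  proof -
    have ed: "T \<inter> path_image (c (a, b)) = {}" if "E a b" "a \<in> set D" "b \<in> set D" for a b
    proof -
      have "{u, v} \<noteq> {a, b}" using nD that by (auto simp: doubleton_eq_iff)
      then have "path_image (c (u, v)) \<inter> path_image (c (a, b)) \<subseteq> {p u, p v}"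
        using edge_curve_Int[OF assms(2) that(1)] by blast
      then show ?thesis by (auto simp: T_def)
    qed
    have "T \<inter> trace c D = {}"
    proof (rule equals0I)
      fix y assume "y \<in> T \<inter> trace c D"
      then obtain i where i: "Suc i < length D" "y \<in> path_image (c (D ! i, D ! Suc i))" "y \<in> T"
        by (auto simp: trace_iff)
      then show False using ed[OF is_path_edge[OF D(1) i(1)]] by auto
    qed
    moreover have "T \<inter> path_image (c (last D, hd D)) = {}" using ed[OF D(2)] D(4) by simp
    ultimately show ?thesis by (auto simp: loop_def)
  qed
  have con: "Topological_Spaces.connected T"
    using connected_simple_path_endless[OF arc_imp_simple_path[OF e(1)]] e(2,3) by (simp add: T_def)
  have Tin: "T \<subseteq> inside (loop D)"
    using connected_Int_frontier[OF con, of "inside (loop D)"] z zT Tl unfolding fr by blast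
  have im: "c (u, v) ` {0<..<1} = T"
    using simple_path_endless[OF arc_imp_simple_path[OF e(1)]] e(2,3) by (simp add: T_def)
  have cl: "path_image (c (u, v)) \<subseteq> closure (inside (loop D))"
  proof -
    have "continuous_on (closure {0<..<1}) (c (u, v))"
      using arc_imp_path[OF e(1)] by (simp add: path_def)
    then have "c (u, v) ` closure {0<..<1} \<subseteq> closure (inside (loop D))"
      using im Tin closure_subset by (intro image_closure_subset) auto
    then show ?thesis by (simp add: path_image_def)
  qed
  have "closure (inside (loop D)) \<subseteq> inside (loop D) \<union> loop D"
    using fr closure_Un_frontier[of "inside (loop D)"] by blast
  then have "p u \<in> loop D" "p v \<in> loop D"
    using cl edge_curve_ends[OF assms(2)] vertex_not_inside[OF assms(1)] uv by blast+
  then show False using loop_vertex[OF assms(1)] uv nD by blast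
qed

text \<open>No vertex and no edge enters the inside, and its frontier belongs to the drawing; so it
  is a connected set that cannot be enlarged within the complement of the drawing.\<close>

lemma induced_cycle_face:
  assumes "induced_cycle E D"
  shows "inside (loop D) \<in> faces G p c" "bounded (inside (loop D))"
    "frontier (inside (loop D)) = loop D"
proof -
  obtain g where g: "simple_path g" "pathfinish g = pathstart g" "path_image g = loop D"
    using simple_loop assms by blast
  have J: "inside (loop D) \<noteq> {}" "Topological_Spaces.connected (inside (loop D))"
    using Jordan_inside_outside[OF g(1,2)] g(3) by simp_all
  show "bounded (inside (loop D))" and fr: "frontier (inside (loop D)) = loop D"
    using Jordan_inside_outside[OF g(1,2)] g(3) by simp_all
  have dis: "inside (loop D) \<inter> drawing G p c = {}"
  proof -
    have "path_image (c e) \<inter> inside (loop D) = {}" if "e \<in> parcs G" for e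
      using edge_not_inside[OF assms, of "fst e" "snd e"] that by (simp add: E_def)
    then show ?thesis using vertex_not_inside[OF assms] by (auto simp: drawing_def)
  qed
  show "inside (loop D) \<in> faces G p c"
    unfolding faces_def in_components_maximal
  proof (intro conjI allI impI J)
    show "inside (loop D) \<subseteq> - drawing G p c" using dis by blast
    fix S assume S: "S \<noteq> {} \<and> inside (loop D) \<subseteq> S \<and> S \<subseteq> - drawing G p c \<and> Topological_Spaces.connected S"
    then have "S \<inter> loop D = {}" using loop_in_drawing[OF assms] by blast
    then have "S - inside (loop D) = {}"
      using connected_Int_frontier[of S "inside (loop D)"] S J(1) unfolding fr by blast
    then show "S = inside (loop D)" using S by blast
  qed
qed

lemma induced_cycle_vertices: "induced_cycle E D \<Longrightarrow> set D \<subseteq> pverts G"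
  using is_path_vertices[of D] induced_cycle_path[of D] by simp

lemma face_determines_vertices:
  assumes C: "induced_cycle E C" and D: "induced_cycle E D" and "inside (loop C) = inside (loop D)"
  shows "set C = set D"
proof -
  have "frontier (inside (loop C)) = frontier (inside (loop D))" using assms(3) by (rule arg_cong)
  then have eq: "loop C = loop D" unfolding induced_cycle_face(3)[OF C] induced_cycle_face(3)[OF D] .
  have "v \<in> set C \<longleftrightarrow> v \<in> set D" if "v \<in> pverts G" for v
    using loop_vertex[OF C that] loop_vertex[OF D that] unfolding eq by blast
  then show ?thesis using induced_cycle_vertices[OF C] induced_cycle_vertices[OF D] by blast
qed

lemma share_edge_weak_dual:
  assumes "induced_cycle E C" "induced_cycle E D" "share_edge E C D" "set C \<noteq> set D"
  shows "(inside (loop C), inside (loop D)) \<in> parcs (weak_dual G p c)"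
    "inside (loop C) \<noteq> inside (loop D)"
proof -
  show ne: "inside (loop C) \<noteq> inside (loop D)"
    using face_determines_vertices[OF assms(1,2)] assms(4) by blast
  obtain u v where uv: "u \<in> set C" "u \<in> set D" "v \<in> set C" "v \<in> set D" "E u v"
    using assms(3) unfolding share_edge_def by blast
  have "path_image (c (u, v)) \<subseteq> frontier (inside (loop C))"
    "path_image (c (u, v)) \<subseteq> frontier (inside (loop D))"
    unfolding induced_cycle_face(3)[OF assms(1)] induced_cycle_face(3)[OF assms(2)]
    using loop_edge[OF assms(1)] loop_edge[OF assms(2)] uv by blast+
  moreover have "(u, v) \<in> parcs G" using uv by (simp add: E_def)
  ultimately show "(inside (loop C), inside (loop D)) \<in> parcs (weak_dual G p c)"
    using ne induced_cycle_face(1,2)[OF assms(1)] induced_cycle_face(1,2)[OF assms(2)]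
    unfolding weak_dual_def pair_pre_digraph.select_convs by blast
qed

lemma no_three_neighbours:
  assumes "path_graph (weak_dual G p c)"
  shows "\<not> three_neighbours E"
proof
  assume "three_neighbours E"
  then obtain D Ds where D: "induced_cycle E D" "length Ds = 3" "distinct (map set (D # Ds))"
    "\<And>C. C \<in> set Ds \<Longrightarrow> induced_cycle E C \<and> share_edge E D C"
    unfolding three_neighbours_def by blast
  obtain xs where xs: "distinct xs" "parcs (weak_dual G p c) = {(xs ! i, xs ! j) | i j.
                     i < length xs \<and> j < length xs \<and> (j = Suc i \<or> i = Suc j)}"
    using assms unfolding path_graph_def by blast
  let ?f = "\<lambda>C. inside (loop C)"
  have adj: "(?f D, ?f C) \<in> parcs (weak_dual G p c)" if "C \<in> set Ds" for C
    using share_edge_weak_dual(1)[OF D(1)] D(3,4) that by force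
  have inj: "inj_on ?f (set Ds)"
  proof (rule inj_onI, rule ccontr)
    fix A B assume AB: "A \<in> set Ds" "B \<in> set Ds" "?f A = ?f B" "A \<noteq> B"
    then have i: "induced_cycle E A" "induced_cycle E B" using D(4) by auto
    have "set A = set B" using face_determines_vertices[OF i AB(3)] .
    moreover have "inj_on set (set Ds)" using D(3) by (auto simp: distinct_map)
    ultimately show False using AB by (auto dest: inj_onD)
  qed
  have "distinct Ds" using D(3) by (simp add: distinct_map)
  then have c3: "card (?f ` set Ds) = 3" using card_image[OF inj] D(2) by (simp add: distinct_card)
  have "Ds \<noteq> []" using D(2) by auto
  then have "(?f D, ?f (hd Ds)) \<in> parcs (weak_dual G p c)" using adj by simp
  then obtain i where i: "i < length xs" "?f D = xs ! i" unfolding xs(2) by auto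
  \<comment> \<open>At the ends of \<open>xs\<close> one of the two entries is out of range or, for
    \<open>i = 0\<close>, equal to \<open>xs ! 0\<close>. Only the bound 2 on the number of
    neighbours matters.\<close>
  have "?f ` set Ds \<subseteq> {xs ! Suc i, xs ! (i - 1)}"
  proof
    fix y assume "y \<in> ?f ` set Ds"
    then have "(xs ! i, y) \<in> parcs (weak_dual G p c)" using adj i by auto
    then obtain k j where kj: "k < length xs" "j < length xs" "xs ! i = xs ! k" "y = xs ! j"
      "j = Suc k \<or> k = Suc j"
      unfolding xs(2) by auto
    then have "k = i" using xs(1) i by (metis nth_eq_iff_index_eq)
    then show "y \<in> {xs ! Suc i, xs ! (i - 1)}" using kj by auto
  qed
  then have "card (?f ` set Ds) \<le> card {xs ! Suc i, xs ! (i - 1)}" by (intro card_mono) auto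
  also have "\<dots> \<le> 2" by (simp add: card_insert_if)
  finally show False using c3 by simp
qed

end

section \<open>Biconnected outerpaths\<close>

theorem theorem1:
  fixes G :: "'a pair_pre_digraph"
  assumes "pair_graph G"
    and "biconnected G"
    and "outerpath G"
  shows "B0_VPG G"
proof -
  obtain p c where pc: "outerplanar_embedding G p c" "path_graph (weak_dual G p c)"
    using assms(3) unfolding outerpath_def by blast
  interpret outerplane_graph G p c by (rule outerplane_graph.intro[OF assms(1) pc(1)])
  have E: "E = (\<lambda>u v. (u, v) \<in> parcs G)" by (intro ext) (simp add: E_def)
  have fin: "finite (pverts G)"
  proof -
    interpret pair_graph G by (rule assms(1))
    show ?thesis by simp
  qed
  define n where "n = card (pverts G)"
  define ham where "ham vs \<longleftrightarrow> cycle E vs \<and> set vs = pverts G" for vs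
  have ham: "length vs = n" "distinct vs" "\<And>i. Suc i < n \<Longrightarrow> E (vs ! i) (vs ! Suc i)"
    "E (vs ! 0) (vs ! (n - 1))"
    "2 \<le> n" if "ham vs" for vs
  proof -
    have *: "cycle E vs" "set vs = pverts G" using that by (auto simp: ham_def)
    show d: "distinct vs" using * by (auto simp: cycle_def is_path_def)
    then show len: "length vs = n" using * unfolding n_def by (metis distinct_card)
    show n2: "2 \<le> n" using * len by (auto simp: cycle_def)
    show "E (vs ! i) (vs ! Suc i)" if "Suc i < n" for i
      using * that len by (auto simp: cycle_def is_path_def successively_conv_nth)
    have "vs \<noteq> []" using len n2 by auto
    then show "E (vs ! 0) (vs ! (n - 1))"
      using * len symp_E by (auto simp: cycle_def hd_conv_nth last_conv_nth dest: sympD)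
  qed
  show ?thesis
  proof (cases "2 \<le> n")
    case False
    then have "card (pverts G) \<le> Suc 0" by (simp add: n_def)
    then show ?thesis
      using card_le_Suc0_iff_eq[OF fin] by (intro complete_B0_VPG) blast
  next
    case True
    have tc: "two_connected E (pverts G)" unfolding E
      by (rule biconnected_two_connected[OF assms(1,2)])
    obtain vs0 where "cycle E vs0" "set vs0 = pverts G"
      using hamiltonian_cycle[OF tc symp_E fin _ _ no_theta] True E_vertices unfolding n_def by metis
    then have vs0: "ham vs0" by (simp add: ham_def)
    show ?thesis
    proof (cases "n = 2")
      case True
      then have "vs0 = [vs0 ! 0, vs0 ! 1]"
        using ham(1)[OF vs0] by (auto intro!: nth_equalityI simp: less_Suc_eq numeral_2_eq_2)
      then have "pverts G = {vs0 ! 0, vs0 ! 1}" using vs0 by (metis ham_def list.set(1,2))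
      moreover have "E (vs0 ! 0) (vs0 ! 1)" "E (vs0 ! 1) (vs0 ! 0)"
        using ham(3)[OF vs0, of 0] True symp_E by (auto dest: sympD)
      ultimately show ?thesis by (intro complete_B0_VPG) (auto simp: E_def)
    next
      case False
      with True have n3: "3 \<le> n" by simp
      \<comment> \<open>A Hamiltonian cycle and a chord from its first vertex cutting off as few vertices as possible:
        the face cut off is an end of the path of faces.\<close>
      define M where "M = {m. \<exists>vs. ham vs \<and> 1 \<le> m \<and> Suc (Suc m) \<le> n \<and> E (vs ! 0) (vs ! m)}"
      have "1 \<in> M" unfolding M_def using vs0 ham(3)[OF vs0, of 0] n3 by auto
      moreover have "finite M" unfolding M_def by (rule finite_subset[of _ "{..n}"]) auto
      ultimately obtain m where m: "m \<in> M" and maxM: "\<And>k. k \<in> M \<Longrightarrow> k \<le> m"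
        using Max_in[of M] Max_ge[of M] by (metis empty_iff)
      obtain vs where vs: "ham vs" and m1: "1 \<le> m" "Suc (Suc m) \<le> n" "E (vs ! 0) (vs ! m)"
        using m unfolding M_def by blast
      note h = ham[OF vs]
      let ?E = "relabel E vs"
      have sym: "symp ?E" using symp_E by (auto simp: symp_def relabel_def)
      have path: "?E i (Suc i)" if "Suc i < n" for i using h that by (simp add: relabel_def)
      have cyc: "?E 0 (n - 1)" using h(1,4) n3 by (simp add: relabel_def)
      have th: "\<not> theta ?E" using theta_relabel[OF h(2)] no_theta by blast
      have three: "\<not> three_neighbours ?E"
        using three_neighbours_relabel[OF h(2)] no_three_neighbours[OF pc(2)] by blast
      show ?thesis
      proof (cases "\<forall>i k j l. i < k \<and> k < j \<and> j < l \<and> l < n \<and> ?E i j \<longrightarrow> \<not> ?E k l")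
        case False
        then obtain i k j l where cr: "i < k" "k < j" "j < l" "l < n" "?E i j" "?E k l" by blast
        then have "\<not> 5 \<le> n" using hamiltonian_noncrossing[OF sym path cyc th] by blast
        \<comment> \<open>With four vertices the crossing chords are the two diagonals of the
          Hamiltonian cycle, so the graph is complete.\<close>
        then have n4: "n = 4" "i = 0" "k = 1" "j = 2" "l = 3" using cr by linarith+
        have "?E a b" if "a < b" "b < 4" for a b
        proof -
          have "(a, b) \<in> {(0, 1), (0, 2), (0, 3), (1, 2), (1, 3), (2, 3)}" using that by auto
          then show ?thesis using cr(5,6) path[of 0] path[of 1] path[of 2] cyc unfolding n4
            by (auto simp: numeral_2_eq_2 numeral_3_eq_3)
        qed
        then have "?E a b" if "a \<noteq> b" "a < 4" "b < 4" for a b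
          using that sym by (metis linorder_neqE_nat sympD)
        then have all: "E (vs ! a) (vs ! b)" if "a \<noteq> b" "a < 4" "b < 4" for a b
          using that by (auto simp: relabel_def)
        show ?thesis
        proof (rule complete_B0_VPG)
          fix u v assume uv: "u \<in> pverts G" "v \<in> pverts G" "u \<noteq> v"
          then have "u \<in> set vs" "v \<in> set vs" using vs by (auto simp: ham_def)
          then obtain a b where "a < 4" "b < 4" "u = vs ! a" "v = vs ! b"
            using h(1) n4(1) by (metis in_set_conv_nth)
          then show "(u, v) \<in> parcs G" using all[of a b] uv(3) by (auto simp: E_def)
        qed
      next
        case nc: True
        have "\<exists>a b. strip ?E {..<n} a b"
        proof (rule strip_hamiltonian[OF sym path cyc _ three m1(1,2)])
          show "\<not> ?E k l" if "i < k" "k < j" "j < l" "l < n" "?E i j" for i k j l using nc that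
            by blast
          show "?E 0 m" using m1 h(1) by (simp add: relabel_def)
          show "\<not> ?E 0 t" if "m < t" "Suc t < n" for t
          proof
            assume "?E 0 t"
            then have "t \<in> M" using that vs unfolding M_def by (auto simp: relabel_def)
            then show False using maxM that by fastforce
          qed
          \<comment> \<open>When the cycle is rotated to begin at \<open>vs ! t\<close>, the vertex
            \<open>vs ! s\<close> gets index \<open>n - (t - s)\<close>. This exceeds
            \<open>m\<close>, so a chord between the two would contradict the choice of
            \<open>m\<close>.\<close>
          show "t = Suc s" if st: "m \<le> s" "s < t" "t < n" "?E s t" for s t
          proof (rule ccontr)
            assume "t \<noteq> Suc s"
            have "ham (rotate t vs)" using vs unfolding ham_def by (simp add: cycle_rotate)
            moreover have "rotate t vs ! 0 = vs ! t" using st h(1) by (simp add: nth_rotate)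
            moreover have "rotate t vs ! (n - (t - s)) = vs ! s"
            proof -
              have "t + (n - (t - s)) = s + n" using st by simp
              then show ?thesis using nth_rotate[of "n - (t - s)" vs t] st h(1) by simp
            qed
            moreover have "E (vs ! t) (vs ! s)" using st(4) symp_E
              by (auto simp: relabel_def dest: sympD)
            moreover have "1 \<le> n - (t - s)" "Suc (Suc (n - (t - s))) \<le> n" using st \<open>t \<noteq> Suc s\<close> by auto
            ultimately have "n - (t - s) \<in> M" unfolding M_def by fastforce
            then show False using maxM[of "n - (t - s)"] st by linarith
          qed
        qed
        then obtain s where s: "draws ?E {..<n} s" using strip_draws sym by metis
        \<comment> \<open>The inverse of the numbering, which carries the drawing of the relabelled
          graph back to \<open>G\<close>.\<close>
        define ix where "ix v = inv_into {..<n} ((!) vs) v" for v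
        have ix: "ix v < n" "vs ! ix v = v" if "v \<in> pverts G" for v
        proof -
          have "v \<in> (!) vs ` {..<n}" using that vs h(1) unfolding ham_def
            by (metis imageI in_set_conv_nth lessThan_iff)
          then show "ix v < n" "vs ! ix v = v"
            using inv_into_into[of v "(!) vs" "{..<n}"] f_inv_into_f[of v "(!) vs" "{..<n}"]
              by (simp_all add: ix_def)
        qed
        have "draws E (pverts G) (\<lambda>v. s (ix v))"
          unfolding draws_def
        proof (intro conjI ballI impI)
          show "is_seg (s (ix v))" if "v \<in> pverts G" for v using s ix[OF that]
            by (auto simp: draws_def)
          fix u v assume uv: "u \<in> pverts G" "v \<in> pverts G" "u \<noteq> v"
          have "ix u \<noteq> ix v" using ix[OF uv(1)] ix[OF uv(2)] uv(3) by metis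
          then have "meets (s (ix u)) (s (ix v)) \<longleftrightarrow> ?E (ix u) (ix v)"
            using s ix[OF uv(1)] ix[OF uv(2)] by (auto simp: draws_def)
          then show "E u v \<longleftrightarrow> meets (s (ix u)) (s (ix v))"
            using ix[OF uv(1)] ix[OF uv(2)] h(1) by (simp add: relabel_def)
        qed
        then show ?thesis unfolding E by (rule draws_B0_VPG)
      qed
    qed
  qed
qed

end
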